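(* Let $\prec$ be any antisymmetric relation on terms. The systems $\mathcal{R}_{12}^r=\{\overline{\mathrm{Ref}},\mathrm{Rep}_1^{r},\mathrm{Rep}_2^{r}\}$ and $\mathcal{R}_{12\prec}^{rl+}$ are equivalent; hence the structural rules are admissible in $\mathbf{G3[mic]}^{\mathcal{R}_{12\prec}^{rl+}}$ (in each of the minimal, intuitionistic and classical cases).
   Context: Formulas are those of a first-order language with equality (constants and function symbols allowed), with bound variables syntactically distinct from free ones; equalities $t=t'$ are atomic; $\bot$ is not counted as atomic. A sequent $\Gamma\Rightarrow\Delta$ consists of finite multisets $\Gamma,\Delta$ of formulas; comma is multiset union. $F[x/r]$ is the result of replacing all free occurrences of $x$ in $F$ by the term $r$. Logical calculi. $\mathbf{G3c}$ has initial sequents $P,\Gamma\Rightarrow\Delta,P$ ($P$ atomic) and the rules: $L\wedge$: from $A,B,\Gamma\Rightarrow\Delta$ infer $A\wedge B,\Gamma\Rightarrow\Delta$. $R\wedge$: from $\Gamma\Rightarrow\Delta,A$ and $\Gamma\Rightarrow\Delta,B$ infer $\Gamma\Rightarrow\Delta,A\wedge B$. $L\vee$: from $A,\Gamma\Rightarrow\Delta$ and $B,\Gamma\Rightarrow\Delta$ infer $A\vee B,\Gamma\Rightarrow\Delta$. $R\vee$: from $\Gamma\Rightarrow\Delta,A,B$ infer $\Gamma\Rightarrow\Delta,A\vee B$. $L\to$: from $\Gamma\Rightarrow\Delta,A$ and $B,\Gamma\Rightarrow\Delta$ infer $A\to B,\Gamma\Rightarrow\Delta$. $R\to$: from $A,\Gamma\Rightarrow\Delta,B$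 infer $\Gamma\Rightarrow\Delta,A\to B$. $L\bot$: infer $\bot,\Gamma\Rightarrow\Delta$ (no premiss). $L\forall$: from $A[x/t],\forall xA,\Gamma\Rightarrow\Delta$ infer $\forall xA,\Gamma\Rightarrow\Delta$. $R\forall$: from $\Gamma\Rightarrow\Delta,A[x/a]$ infer $\Gamma\Rightarrow\Delta,\forall xA$. $L\exists$: from $A[x/a],\Gamma\Rightarrow\Delta$ infer $\exists xA,\Gamma\Rightarrow\Delta$. $R\exists$: from $\Gamma\Rightarrow\Delta,\exists xA,A[x/t]$ infer $\Gamma\Rightarrow\Delta,\exists xA$. In $L\exists$ and the $R\forall$ rules, $a$ is a free variable not occurring in the conclusion. $\mathbf{G3i}$ is $\mathbf{G3c}$ with $L\to,R\to,R\forall$ replaced by: $L^i\to$: from $A\to B,\Gamma\Rightarrow\Delta,A$ and $B,\Gamma\Rightarrow\Delta$ infer $A\to B,\Gamma\Rightarrow\Delta$; $R^i\to$: from $A,\Gamma\Rightarrow B$ infer $\Gamma\Rightarrow\Delta,A\to B$; $R^i\forall$: from $\Gamma\Rightarrow A[x/a]$ infer $\Gamma\Rightarrow\Delta,\forall xA$. $\mathbf{G3m}$ is $\mathbf{G3i}$ with $L\bot$ replaced by the initial sequents $\bot,\Gamma\Rightarrow\Delta,\bot$. $\mathbf{G3[mic]}$ denotes any of the three; $\mathbf{G3[mic]}^{\mathcal R}$ is it together with the rules in $\mathcal R$. A set $\mathcal R$ of rules is identified with the calculus whose initial sequents are $P,\Gamma\Rightarrow\Delta,P$ ($P$ atomic)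 together with $\bot,\Gamma\Rightarrow\Delta$ in the intuitionistic and classical case, respectively $\bot,\Gamma\Rightarrow\Delta,\bot$ in the minimal case, and whose rules are those of $\mathcal R$ (no logical rules); statements about $\mathcal R$ are meant for each of these cases. Two calculi are equivalent if they derive the same sequents. Structural rules: weakening (from $\Gamma\Rightarrow\Delta$ infer $A,\Gamma\Rightarrow\Delta$; from $\Gamma\Rightarrow\Delta$ infer $\Gamma\Rightarrow\Delta,A$), contraction (from $A,A,\Gamma\Rightarrow\Delta$ infer $A,\Gamma\Rightarrow\Delta$; from $\Gamma\Rightarrow\Delta,A,A$ infer $\Gamma\Rightarrow\Delta,A$), and Cut (from $\Gamma\Rightarrow\Delta,A$ and $A,\Lambda\Rightarrow\Theta$ infer $\Gamma,\Lambda\Rightarrow\Delta,\Theta$), for arbitrary formulas $A$. A rule is admissible in a calculus if its conclusion is derivable whenever its premisses are. Equality rules ($P$ atomic, possibly an equality); the first antecedent formula displayed in each rule below is its operating equality. $\overline{\mathrm{Ref}}$: axioms $\Gamma\Rightarrow\Delta,t=t$. $\mathrm{Rep}_1^{r}$: from $r=s,\Gamma\Rightarrow\Delta,P[x/r]$ infer $r=s,\Gamma\Rightarrow\Delta,P[x/s]$. $\mathrm{Rep}_2^{r}$: from $s=r,\Gamma\Rightarrow\Delta,P[x/r]$ infer $s=r,\Gamma\Rightarrow\Delta,P[x/s]$. $\mathrm{Rep}_1^{l}$: from $r=s,P[x/r],\Gamma\Rightarrow\Delta$ infer $r=s,P[x/s],\Gamma\Rightarrow\Delta$. $\mathrm{Rep}_2^{l}$: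 from $s=r,P[x/r],\Gamma\Rightarrow\Delta$ infer $s=r,P[x/s],\Gamma\Rightarrow\Delta$. $\mathrm{Rep}_1^{l+}$: the rule $\mathrm{Rep}_1^{l}$ with its instances in which $P$ is an equality $E$ replaced by: from $r=s,E[x/s],E[x/r],\Gamma\Rightarrow\Delta$ infer $r=s,E[x/s],\Gamma\Rightarrow\Delta$. $\mathrm{Rep}_2^{l+}$: the rule $\mathrm{Rep}_2^{l}$ with its instances in which $P$ is an equality $E$ replaced by: from $s=r,E[x/s],E[x/r],\Gamma\Rightarrow\Delta$ infer $s=r,E[x/s],\Gamma\Rightarrow\Delta$. With $r,s$ as in the schemata above, an application of a rule with operating equality $r=s$ (index $1$) or $s=r$ (index $2$) is nonlengthening if $s\not\prec r$ and shortening if $r\prec s$. $\mathcal{R}_{12}^{rl+}=\{\overline{\mathrm{Ref}},\mathrm{Rep}_1^{l+},\mathrm{Rep}_2^{l+},\mathrm{Rep}_1^{r},\mathrm{Rep}_2^{r}\}$, and $\mathcal{R}_{12\prec}^{rl+}$ is $\mathcal{R}_{12}^{rl+}$ with the applications of $\mathrm{Rep}_1^{l+}$ and $\mathrm{Rep}_1^{r}$ required to be shortening and the applications of $\mathrm{Rep}_2^{l+}$ and $\mathrm{Rep}_2^{r}$ required to be nonlengthening. *)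

theory Defs
  imports Main "HOL-Library.Multiset"
begin

(* Free and bound variables are syntactically distinct. A signature lists the admitted
   (symbol, arity) pairs; constants and propositional letters are the symbols of arity 0. *)

datatype var = Free nat | Bound nat

datatype 'f tm = Var var | Fn 'f "'f tm list"

datatype ('f, 'p) fm =
    Falsum
  | Eq "'f tm" "'f tm"
  | Pred 'p "'f tm list"
  | Conj "('f, 'p) fm" "('f, 'p) fm"
  | Disj "('f, 'p) fm" "('f, 'p) fm"
  | Imp "('f, 'p) fm" "('f, 'p) fm"
  | All nat "('f, 'p) fm"
  | Ex nat "('f, 'p) fm"

record ('f, 'p) signature =
  funs :: "('f \<times> nat) set"
  preds :: "('p \<times> nat) set"

(* The set B collects the bound variables whose quantifier has already been passed. *)

fun wf_tm :: "('f, 'p) signature \<Rightarrow> nat set \<Rightarrow> 'f tm \<Rightarrow> bool" where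
  "wf_tm S B (Var (Free a)) = True"
| "wf_tm S B (Var (Bound x)) = (x \<in> B)"
| "wf_tm S B (Fn f ts) = ((f, length ts) \<in> funs S \<and> (\<forall>t\<in>set ts. wf_tm S B t))"

fun wf_fm :: "('f, 'p) signature \<Rightarrow> nat set \<Rightarrow> ('f, 'p) fm \<Rightarrow> bool" where
  "wf_fm S B Falsum = True"
| "wf_fm S B (Eq t u) = (wf_tm S B t \<and> wf_tm S B u)"
| "wf_fm S B (Pred p ts) = ((p, length ts) \<in> preds S \<and> (\<forall>t\<in>set ts. wf_tm S B t))"
| "wf_fm S B (Conj F G) = (wf_fm S B F \<and> wf_fm S B G)"
| "wf_fm S B (Disj F G) = (wf_fm S B F \<and> wf_fm S B G)"
| "wf_fm S B (Imp F G) = (wf_fm S B F \<and> wf_fm S B G)"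
| "wf_fm S B (All x F) = wf_fm S (insert x B) F"
| "wf_fm S B (Ex x F) = wf_fm S (insert x B) F"

definition is_term :: "('f, 'p) signature \<Rightarrow> 'f tm \<Rightarrow> bool" where
  "is_term S t \<longleftrightarrow> wf_tm S {} t"

definition is_formula :: "('f, 'p) signature \<Rightarrow> ('f, 'p) fm \<Rightarrow> bool" where
  "is_formula S F \<longleftrightarrow> wf_fm S {} F"

definition equality :: "('f, 'p) fm \<Rightarrow> bool" where
  "equality F \<longleftrightarrow> (\<exists>t u. F = Eq t u)"

definition atomic :: "('f, 'p) fm \<Rightarrow> bool" where
  "atomic F \<longleftrightarrow> equality F \<or> (\<exists>p ts. F = Pred p ts)"

(* subst_fm x r F is F[x/r]. The substituted terms r contain no bound variables,
   so there is no capture. *)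

fun subst_tm :: "var \<Rightarrow> 'f tm \<Rightarrow> 'f tm \<Rightarrow> 'f tm" where
  "subst_tm x r (Var y) = (if y = x then r else Var y)"
| "subst_tm x r (Fn f ts) = Fn f (map (subst_tm x r) ts)"

fun subst_fm :: "var \<Rightarrow> 'f tm \<Rightarrow> ('f, 'p) fm \<Rightarrow> ('f, 'p) fm" where
  "subst_fm x r Falsum = Falsum"
| "subst_fm x r (Eq t u) = Eq (subst_tm x r t) (subst_tm x r u)"
| "subst_fm x r (Pred p ts) = Pred p (map (subst_tm x r) ts)"
| "subst_fm x r (Conj F G) = Conj (subst_fm x r F) (subst_fm x r G)"
| "subst_fm x r (Disj F G) = Disj (subst_fm x r F) (subst_fm x r G)"
| "subst_fm x r (Imp F G) = Imp (subst_fm x r F) (subst_fm x r G)"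
| "subst_fm x r (All y F) = All y (if x = Bound y then F else subst_fm x r F)"
| "subst_fm x r (Ex y F) = Ex y (if x = Bound y then F else subst_fm x r F)"

fun fv_tm :: "'f tm \<Rightarrow> nat set" where
  "fv_tm (Var (Free a)) = {a}"
| "fv_tm (Var (Bound x)) = {}"
| "fv_tm (Fn f ts) = (\<Union>t\<in>set ts. fv_tm t)"

fun fv_fm :: "('f, 'p) fm \<Rightarrow> nat set" where
  "fv_fm Falsum = {}"
| "fv_fm (Eq t u) = fv_tm t \<union> fv_tm u"
| "fv_fm (Pred p ts) = (\<Union>t\<in>set ts. fv_tm t)"
| "fv_fm (Conj F G) = fv_fm F \<union> fv_fm G"
| "fv_fm (Disj F G) = fv_fm F \<union> fv_fm G"
| "fv_fm (Imp F G) = fv_fm F \<union> fv_fm G"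
| "fv_fm (All x F) = fv_fm F"
| "fv_fm (Ex x F) = fv_fm F"

datatype ('f, 'p) seq =
  Sequent (ante: "('f, 'p) fm multiset") (succ: "('f, 'p) fm multiset")  (infix "\<turnstile>" 50)

definition is_sequent :: "('f, 'p) signature \<Rightarrow> ('f, 'p) seq \<Rightarrow> bool" where
  "is_sequent S s \<longleftrightarrow> (\<forall>F \<in># ante s + succ s. is_formula S F)"

definition fv_seq :: "('f, 'p) seq \<Rightarrow> nat set" where
  "fv_seq s = (\<Union>F \<in> set_mset (ante s + succ s). fv_fm F)"

(* A rule is the set of its instances (premisses, conclusion), initial sequents being rules
   without premisses; a calculus is a set of rules. Instances may be written over raw syntax:
   derivability and admissibility only consider those consisting of sequents of the
   language S. *)

type_synonym ('f, 'p) rule = "(('f, 'p) seq list \<times> ('f, 'p) seq) set"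

inductive derivable :: "('f, 'p) signature \<Rightarrow> ('f, 'p) rule set \<Rightarrow> ('f, 'p) seq \<Rightarrow> bool"
  for S :: "('f, 'p) signature" and C :: "('f, 'p) rule set" where
  step: "\<rho> \<in> C \<Longrightarrow> (ps, c) \<in> \<rho> \<Longrightarrow> is_sequent S c \<Longrightarrow> (\<And>p. p \<in> set ps \<Longrightarrow> derivable S C p)
    \<Longrightarrow> derivable S C c"

definition equivalent ::
  "('f, 'p) signature \<Rightarrow> ('f, 'p) rule set \<Rightarrow> ('f, 'p) rule set \<Rightarrow> bool" where
  "equivalent S C D \<longleftrightarrow> (\<forall>s. derivable S C s \<longleftrightarrow> derivable S D s)"

definition admissible ::
  "('f, 'p) signature \<Rightarrow> ('f, 'p) rule set \<Rightarrow> ('f, 'p) rule \<Rightarrow> bool" where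
  "admissible S C \<rho> \<longleftrightarrow> (\<forall>(ps, c) \<in> \<rho>. is_sequent S c \<longrightarrow> (\<forall>p \<in> set ps. derivable S C p)
    \<longrightarrow> derivable S C c)"

datatype logic = Minimal | Intuitionistic | Classical

definition Init :: "('f, 'p) rule" where
  "Init = {([], add_mset P \<Gamma> \<turnstile> add_mset P \<Delta>) | P \<Gamma> \<Delta>. atomic P}"

definition L_bot :: "('f, 'p) rule" where
  "L_bot = {([], add_mset Falsum \<Gamma> \<turnstile> \<Delta>) | \<Gamma> \<Delta>. True}"

definition Init_bot :: "('f, 'p) rule" where
  "Init_bot = {([], add_mset Falsum \<Gamma> \<turnstile> add_mset Falsum \<Delta>) | \<Gamma> \<Delta>. True}"

fun initial :: "logic \<Rightarrow> ('f, 'p) rule set" where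
  "initial Minimal = {Init, Init_bot}"
| "initial Intuitionistic = {Init, L_bot}"
| "initial Classical = {Init, L_bot}"

definition L_conj :: "('f, 'p) rule" where
  "L_conj = {([add_mset A (add_mset B \<Gamma>) \<turnstile> \<Delta>], add_mset (Conj A B) \<Gamma> \<turnstile> \<Delta>) | A B \<Gamma> \<Delta>. True}"

definition R_conj :: "('f, 'p) rule" where
  "R_conj = {([\<Gamma> \<turnstile> add_mset A \<Delta>, \<Gamma> \<turnstile> add_mset B \<Delta>], \<Gamma> \<turnstile> add_mset (Conj A B) \<Delta>) | A B \<Gamma> \<Delta>. True}"

definition L_disj :: "('f, 'p) rule" where
  "L_disj = {([add_mset A \<Gamma> \<turnstile> \<Delta>, add_mset B \<Gamma> \<turnstile> \<Delta>], add_mset (Disj A B) \<Gamma> \<turnstile> \<Delta>) | A B \<Gamma> \<Delta>. True}"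

definition R_disj :: "('f, 'p) rule" where
  "R_disj = {([\<Gamma> \<turnstile> add_mset A (add_mset B \<Delta>)], \<Gamma> \<turnstile> add_mset (Disj A B) \<Delta>) | A B \<Gamma> \<Delta>. True}"

definition L_imp :: "('f, 'p) rule" where
  "L_imp = {([\<Gamma> \<turnstile> add_mset A \<Delta>, add_mset B \<Gamma> \<turnstile> \<Delta>], add_mset (Imp A B) \<Gamma> \<turnstile> \<Delta>) | A B \<Gamma> \<Delta>. True}"

definition R_imp :: "('f, 'p) rule" where
  "R_imp = {([add_mset A \<Gamma> \<turnstile> add_mset B \<Delta>], \<Gamma> \<turnstile> add_mset (Imp A B) \<Delta>) | A B \<Gamma> \<Delta>. True}"

definition Li_imp :: "('f, 'p) rule" where
  "Li_imp = {([add_mset (Imp A B) \<Gamma> \<turnstile> add_mset A \<Delta>, add_mset B \<Gamma> \<turnstile> \<Delta>],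
      add_mset (Imp A B) \<Gamma> \<turnstile> \<Delta>) | A B \<Gamma> \<Delta>. True}"

definition Ri_imp :: "('f, 'p) rule" where
  "Ri_imp = {([add_mset A \<Gamma> \<turnstile> {#B#}], \<Gamma> \<turnstile> add_mset (Imp A B) \<Delta>) | A B \<Gamma> \<Delta>. True}"

definition L_all :: "('f, 'p) signature \<Rightarrow> ('f, 'p) rule" where
  "L_all S = {([add_mset (subst_fm (Bound x) t A) (add_mset (All x A) \<Gamma>) \<turnstile> \<Delta>],
      add_mset (All x A) \<Gamma> \<turnstile> \<Delta>) | x t A \<Gamma> \<Delta>. is_term S t}"

definition R_all :: "('f, 'p) rule" where
  "R_all = {([\<Gamma> \<turnstile> add_mset (subst_fm (Bound x) (Var (Free a)) A) \<Delta>],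
      \<Gamma> \<turnstile> add_mset (All x A) \<Delta>) | x a A \<Gamma> \<Delta>. a \<notin> fv_seq (\<Gamma> \<turnstile> add_mset (All x A) \<Delta>)}"

definition Ri_all :: "('f, 'p) rule" where
  "Ri_all = {([\<Gamma> \<turnstile> {#subst_fm (Bound x) (Var (Free a)) A#}],
      \<Gamma> \<turnstile> add_mset (All x A) \<Delta>) | x a A \<Gamma> \<Delta>. a \<notin> fv_seq (\<Gamma> \<turnstile> add_mset (All x A) \<Delta>)}"

definition L_ex :: "('f, 'p) rule" where
  "L_ex = {([add_mset (subst_fm (Bound x) (Var (Free a)) A) \<Gamma> \<turnstile> \<Delta>],
      add_mset (Ex x A) \<Gamma> \<turnstile> \<Delta>) | x a A \<Gamma> \<Delta>. a \<notin> fv_seq (add_mset (Ex x A) \<Gamma> \<turnstile> \<Delta>)}"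

definition R_ex :: "('f, 'p) signature \<Rightarrow> ('f, 'p) rule" where
  "R_ex S = {([\<Gamma> \<turnstile> add_mset (Ex x A) (add_mset (subst_fm (Bound x) t A) \<Delta>)],
      \<Gamma> \<turnstile> add_mset (Ex x A) \<Delta>) | x t A \<Gamma> \<Delta>. is_term S t}"

definition common_rules :: "('f, 'p) signature \<Rightarrow> ('f, 'p) rule set" where
  "common_rules S = {L_conj, R_conj, L_disj, R_disj, L_all S, L_ex, R_ex S}"

fun specific_rules :: "logic \<Rightarrow> ('f, 'p) rule set" where
  "specific_rules Minimal = {Li_imp, Ri_imp, Ri_all}"
| "specific_rules Intuitionistic = {Li_imp, Ri_imp, Ri_all}"
| "specific_rules Classical = {L_imp, R_imp, R_all}"

definition G3 :: "('f, 'p) signature \<Rightarrow> logic \<Rightarrow> ('f, 'p) rule set" where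
  "G3 S l = initial l \<union> common_rules S \<union> specific_rules l"

definition WeakL :: "('f, 'p) rule" where
  "WeakL = {([\<Gamma> \<turnstile> \<Delta>], add_mset A \<Gamma> \<turnstile> \<Delta>) | A \<Gamma> \<Delta>. True}"

definition WeakR :: "('f, 'p) rule" where
  "WeakR = {([\<Gamma> \<turnstile> \<Delta>], \<Gamma> \<turnstile> add_mset A \<Delta>) | A \<Gamma> \<Delta>. True}"

definition ContrL :: "('f, 'p) rule" where
  "ContrL = {([add_mset A (add_mset A \<Gamma>) \<turnstile> \<Delta>], add_mset A \<Gamma> \<turnstile> \<Delta>) | A \<Gamma> \<Delta>. True}"

definition ContrR :: "('f, 'p) rule" where
  "ContrR = {([\<Gamma> \<turnstile> add_mset A (add_mset A \<Delta>)], \<Gamma> \<turnstile> add_mset A \<Delta>) | A \<Gamma> \<Delta>. True}"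

definition Cut :: "('f, 'p) rule" where
  "Cut = {([\<Gamma> \<turnstile> add_mset A \<Delta>, add_mset A \<Lambda> \<turnstile> \<Theta>], \<Gamma> + \<Lambda> \<turnstile> \<Delta> + \<Theta>) | A \<Gamma> \<Delta> \<Lambda> \<Theta>. True}"

definition structural_rules :: "('f, 'p) rule set" where
  "structural_rules = {WeakL, WeakR, ContrL, ContrR, Cut}"

definition Ref :: "('f, 'p) rule" where
  "Ref = {([], \<Gamma> \<turnstile> add_mset (Eq t t) \<Delta>) | t \<Gamma> \<Delta>. True}"

(* The argument Q restricts the applications of a replacement rule, in terms of r and s
   (the premiss has P[x/r] and the conclusion P[x/s]). *)

definition Rep_r1 :: "('f tm \<Rightarrow> 'f tm \<Rightarrow> bool) \<Rightarrow> ('f, 'p) rule" where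
  "Rep_r1 Q = {([add_mset (Eq r s) \<Gamma> \<turnstile> add_mset (subst_fm (Free x) r P) \<Delta>],
      add_mset (Eq r s) \<Gamma> \<turnstile> add_mset (subst_fm (Free x) s P) \<Delta>) | r s x P \<Gamma> \<Delta>.
      atomic P \<and> Q r s}"

definition Rep_r2 :: "('f tm \<Rightarrow> 'f tm \<Rightarrow> bool) \<Rightarrow> ('f, 'p) rule" where
  "Rep_r2 Q = {([add_mset (Eq s r) \<Gamma> \<turnstile> add_mset (subst_fm (Free x) r P) \<Delta>],
      add_mset (Eq s r) \<Gamma> \<turnstile> add_mset (subst_fm (Free x) s P) \<Delta>) | r s x P \<Gamma> \<Delta>.
      atomic P \<and> Q r s}"

definition Rep_lplus1 :: "('f tm \<Rightarrow> 'f tm \<Rightarrow> bool) \<Rightarrow> ('f, 'p) rule" where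
  "Rep_lplus1 Q =
    {([add_mset (Eq r s) (add_mset (subst_fm (Free x) r P) \<Gamma>) \<turnstile> \<Delta>],
      add_mset (Eq r s) (add_mset (subst_fm (Free x) s P) \<Gamma>) \<turnstile> \<Delta>) | r s x P \<Gamma> \<Delta>.
      atomic P \<and> \<not> equality P \<and> Q r s} \<union>
    {([add_mset (Eq r s) (add_mset (subst_fm (Free x) s E) (add_mset (subst_fm (Free x) r E) \<Gamma>)) \<turnstile> \<Delta>],
      add_mset (Eq r s) (add_mset (subst_fm (Free x) s E) \<Gamma>) \<turnstile> \<Delta>) | r s x E \<Gamma> \<Delta>.
      equality E \<and> Q r s}"

definition Rep_lplus2 :: "('f tm \<Rightarrow> 'f tm \<Rightarrow> bool) \<Rightarrow> ('f, 'p) rule" where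
  "Rep_lplus2 Q =
    {([add_mset (Eq s r) (add_mset (subst_fm (Free x) r P) \<Gamma>) \<turnstile> \<Delta>],
      add_mset (Eq s r) (add_mset (subst_fm (Free x) s P) \<Gamma>) \<turnstile> \<Delta>) | r s x P \<Gamma> \<Delta>.
      atomic P \<and> \<not> equality P \<and> Q r s} \<union>
    {([add_mset (Eq s r) (add_mset (subst_fm (Free x) s E) (add_mset (subst_fm (Free x) r E) \<Gamma>)) \<turnstile> \<Delta>],
      add_mset (Eq s r) (add_mset (subst_fm (Free x) s E) \<Gamma>) \<turnstile> \<Delta>) | r s x E \<Gamma> \<Delta>.
      equality E \<and> Q r s}"

definition nonlengthening :: "('f tm \<Rightarrow> 'f tm \<Rightarrow> bool) \<Rightarrow> 'f tm \<Rightarrow> 'f tm \<Rightarrow> bool" where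
  "nonlengthening prec r s \<longleftrightarrow> \<not> prec s r"

definition shortening :: "('f tm \<Rightarrow> 'f tm \<Rightarrow> bool) \<Rightarrow> 'f tm \<Rightarrow> 'f tm \<Rightarrow> bool" where
  "shortening prec r s \<longleftrightarrow> prec r s"

definition R12_r :: "('f, 'p) rule set" where
  "R12_r = {Ref, Rep_r1 (\<lambda>_ _. True), Rep_r2 (\<lambda>_ _. True)}"

definition R12_rlplus_prec :: "('f tm \<Rightarrow> 'f tm \<Rightarrow> bool) \<Rightarrow> ('f, 'p) rule set" where
  "R12_rlplus_prec prec =
    {Ref, Rep_lplus1 (shortening prec), Rep_lplus2 (nonlengthening prec),
     Rep_r1 (shortening prec), Rep_r2 (nonlengthening prec)}"

end

theory Submission
  imports Defs "HOL-Library.Confluence"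
begin

text \<open>The equality calculi and the logical calculi meet in one notion: a sequent is axiomatic if it is
closed by \<open>\<bottom>\<close> or if some prime formula of its succedent follows from the antecedent by the
congruence that the equalities of the antecedent generate.

Both equality calculi derive exactly the axiomatic sequents. Soundness holds because every equality
rule is a cut with an axiomatic sequent (\<open>equality_rule_closed\<close>). In the unrestricted calculus
completeness is the remark that congruent terms are connected by a chain of replacements. In the
restricted calculus every antecedent equality, read from the conclusion to the premiss, acts as a
rewrite rule in one direction only: it replaces \<open>b\<close> by \<open>a\<close> if \<open>a \<prec> b\<close>, and \<open>a\<close> by \<open>b\<close> otherwise.
These rewrite steps need not terminate. The left rules, however, can add to the antecedent whatever
arises by rewriting a side of one equality with another one. If one equality acts as \<open>s \<rightarrow> r\<close> and
another one rewrites \<open>s\<close> to \<open>t\<close>, then \<open>t = r\<close> or \<open>r = t\<close> is among the added equalities; whatever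
its direction, it closes the peak \<open>r \<leftarrow> s \<rightarrow> t\<close> in one step. So in the saturated system
every peak closes with at most one step on each side (\<open>saturated_peak\<close>), which yields confluence
without termination, and congruent terms have a common reduct (\<open>saturated_join\<close>) that the restricted
rules reach (\<open>restricted_complete\<close>).

For the structural rules, the equality rules change atomic formulas only and never a formula that is
principal in a logical rule, so they can all be moved to the top of a derivation. Hence the full
calculus derives the same sequents as the logical rules alone with axiomatic sequents as leaves. The
predicate \<open>prov\<close> is that calculus with the eigenvariable rules replaced by rules that have one
premiss for every term. It admits weakening, inversion, contraction and cut by inductions on
formulas and derivations that never rename a variable; a cut on a prime formula reduces to the leaves,
where it is transitivity of consequence. A derivation of the original calculus gives a proof of each
of its substitution instances, the equality rules being simulated by cuts (\<open>calculus_sound\<close>);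
conversely a family of premisses is replaced by its member at a fresh variable
(\<open>calculus_complete\<close>).\<close>

section \<open>Congruence closure and entailment between prime formulas\<close>

inductive eqv :: "('f tm \<times> 'f tm) set \<Rightarrow> 'f tm \<Rightarrow> 'f tm \<Rightarrow> bool" for E where
  base: "(t, u) \<in> E \<Longrightarrow> eqv E t u"
| refl: "eqv E t t"
| sym: "eqv E t u \<Longrightarrow> eqv E u t"
| trans: "eqv E t u \<Longrightarrow> eqv E u v \<Longrightarrow> eqv E t v"
| cong: "list_all2 (eqv E) ts us \<Longrightarrow> eqv E (Fn f ts) (Fn f us)"

lemma eqvs_refl: "list_all2 (eqv E) ts ts"
  by (simp add: eqv.refl list_all2_refl)

lemma eqvs_trans: "list_all2 (eqv E) ts us \<Longrightarrow> list_all2 (eqv E) us vs \<Longrightarrow> list_all2 (eqv E) ts vs"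
  using list_all2_trans[of "eqv E" "eqv E" "eqv E"] eqv.trans by blast

text \<open>Congruence closure is a closure operator: this is how consequences are transferred from one set of
equations to another.\<close>

lemma eqv_closed:
  assumes "eqv E t u" "\<And>t u. (t, u) \<in> E \<Longrightarrow> eqv E' t u"
  shows "eqv E' t u"
  using assms(1)
proof induction
  case (cong ts us f)
  then have "list_all2 (eqv E') ts us" by (auto elim: list_all2_mono)
  then show ?case by (rule eqv.cong)
next
  case (sym t u)
  from sym.IH show ?case by (rule eqv.sym)
next
  case (trans t u v)
  from trans.IH show ?case by (rule eqv.trans)
qed (fact assms(2), rule eqv.refl)

definition equations :: "('f, 'p) fm set \<Rightarrow> ('f tm \<times> 'f tm) set" where
  "equations G = {(t, u). Eq t u \<in> G}"

text \<open>Consequence between prime formulas in the theory of equality. \<open>\<bottom>\<close> is treated as an inert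
propositional atom, which is its role in minimal logic; \<open>ex falso\<close> is added in the definition of
axiomatic sequents.\<close>

fun entails :: "('f, 'p) fm set \<Rightarrow> ('f, 'p) fm \<Rightarrow> bool" where
  "entails G Falsum = (Falsum \<in> G)"
| "entails G (Eq t u) = eqv (equations G) t u"
| "entails G (Pred p us) = (\<exists>ts. Pred p ts \<in> G \<and> list_all2 (eqv (equations G)) ts us)"
| "entails G _ = False"

definition prime :: "('f, 'p) fm \<Rightarrow> bool" where
  "prime A \<longleftrightarrow> A = Falsum \<or> atomic A"

lemma prime_simps [simp]:
  "prime Falsum" "prime (Eq t u)" "prime (Pred p ts)"
  "\<not> prime (Conj A B)" "\<not> prime (Disj A B)" "\<not> prime (Imp A B)" "\<not> prime (All x A)" "\<not> prime (Ex x A)"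
  by (auto simp: prime_def atomic_def equality_def)

lemma entails_prime: "entails G A \<Longrightarrow> prime A"
  by (cases A) auto

lemma entails_member: "A \<in> G \<Longrightarrow> prime A \<Longrightarrow> entails G A"
  by (cases A) (auto simp: equations_def intro: eqv.base eqvs_refl)

text \<open>An entailed equality adds nothing to the generated congruence, and an entailed atom can be traced
back to an atom of the original antecedent by transitivity. This is the whole of cut elimination for
prime formulas.\<close>

lemma entails_cut:
  assumes "entails G A" "entails (insert A G) B"
  shows "entails G B"
proof -
  have eq: "eqv (equations G) t u" if "eqv (equations (insert A G)) t u" for t u
    using that
  proof (rule eqv_closed)
    fix t u
    assume "(t, u) \<in> equations (insert A G)"
    then show "eqv (equations G) t u"
      using assms(1) by (auto simp: equations_def intro: eqv.base)
  qed
  then have eqs: "list_all2 (eqv (equations G)) ts us"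
    if "list_all2 (eqv (equations (insert A G))) ts us" for ts us
    using that by (auto elim: list_all2_mono)
  show ?thesis
  proof (cases B)
    case Falsum
    then show ?thesis using assms by auto
  next
    case (Eq t u)
    then show ?thesis using assms(2) eq by simp
  next
    case (Pred p us)
    then obtain ts where "Pred p ts \<in> insert A G" and ts: "list_all2 (eqv (equations G)) ts us"
      using assms(2) eqs by auto
    then have "entails G (Pred p ts)"
      using assms(1) entails_member[of "Pred p ts" G] by auto
    then obtain ts' where "Pred p ts' \<in> G" "list_all2 (eqv (equations G)) ts' ts"
      by auto
    then show ?thesis
      using Pred eqvs_trans[OF _ ts] by auto
  qed (use assms(2) in simp_all)
qed

text \<open>Only the prime formulas of the antecedent matter, so compound formulas may be dropped from it.\<close>

lemma entails_mono:
  assumes "entails G A" "\<And>B. B \<in> G \<Longrightarrow> prime B \<Longrightarrow> B \<in> H"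
  shows "entails H A"
proof -
  have eq: "eqv (equations H) t u" if "eqv (equations G) t u" for t u
    using that
  proof (rule eqv_closed)
    fix t u :: "'a tm"
    assume "(t, u) \<in> equations G"
    then have "(t, u) \<in> equations H" by (simp add: equations_def assms(2))
    then show "eqv (equations H) t u" by (rule eqv.base)
  qed
  then have eqs: "list_all2 (eqv (equations H)) ts us"
    if "list_all2 (eqv (equations G)) ts us" for ts us
    using that by (auto elim: list_all2_mono)
  show ?thesis
    using assms eq eqs by (cases A) (simp_all, metis prime_simps(3))
qed

lemma eqv_subst_tm:
  assumes "eqv E r s"
  shows "eqv E (subst_tm x r t) (subst_tm x s t)"
proof (induction t)
  case (Fn f ts)
  then have "list_all2 (eqv E) (map (subst_tm x r) ts) (map (subst_tm x s) ts)"
    by (auto simp: list_all2_conv_all_nth)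
  then show ?case by (auto intro: eqv.cong)
qed (auto intro: eqv.refl assms)

lemma entails_replacement:
  assumes "eqv (equations G) r s" "subst_fm (Free x) r P \<in> G" "atomic P"
  shows "entails G (subst_fm (Free x) s P)"
proof (cases P)
  case (Eq t u)
  have "eqv (equations G) (subst_tm (Free x) r t) (subst_tm (Free x) r u)"
    using assms(2) Eq by (auto simp: equations_def intro: eqv.base)
  moreover have "eqv (equations G) (subst_tm (Free x) s t) (subst_tm (Free x) r t)"
    "eqv (equations G) (subst_tm (Free x) r u) (subst_tm (Free x) s u)"
    using assms(1) by (auto intro: eqv_subst_tm eqv.sym)
  ultimately show ?thesis
    using Eq by (auto intro: eqv.trans)
next
  case (Pred p ts)
  then show ?thesis
    using assms by (auto simp: list_all2_conv_all_nth intro!: eqv_subst_tm exI[of _ "map (subst_tm (Free x) r) ts"])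
qed (use assms(3) in \<open>auto simp: atomic_def equality_def\<close>)

section \<open>Axiomatic sequents\<close>

datatype ('f, 'p) signed_fm = Lft "('f, 'p) fm" | Rgt "('f, 'p) fm"

text \<open>Writing a sequent as one multiset of signed formulas lets each structural property be proved once for
both sides.\<close>

fun signed :: "('f, 'p) seq \<Rightarrow> ('f, 'p) signed_fm multiset" where
  "signed (\<Gamma> \<turnstile> \<Delta>) = image_mset Lft \<Gamma> + image_mset Rgt \<Delta>"

definition lefts :: "('f, 'p) signed_fm multiset \<Rightarrow> ('f, 'p) fm set" where
  "lefts M = {A. Lft A \<in># M}"

definition axiomatic :: "logic \<Rightarrow> ('f, 'p) signed_fm multiset \<Rightarrow> bool" where
  "axiomatic l M \<longleftrightarrow> l \<noteq> Minimal \<and> Lft Falsum \<in># M \<or> (\<exists>A. Rgt A \<in># M \<and> entails (lefts M) A)"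

lemma lefts_signed [simp]: "lefts (signed (\<Gamma> \<turnstile> \<Delta>)) = set_mset \<Gamma>"
  by (auto simp: lefts_def)

lemma axiomatic_signed:
  "axiomatic l (signed (\<Gamma> \<turnstile> \<Delta>)) \<longleftrightarrow>
    l \<noteq> Minimal \<and> Falsum \<in># \<Gamma> \<or> (\<exists>A. A \<in># \<Delta> \<and> entails (set_mset \<Gamma>) A)"
  unfolding axiomatic_def lefts_signed by auto

lemma lefts_add [simp]:
  "lefts (add_mset (Lft A) M) = insert A (lefts M)" "lefts (add_mset (Rgt A) M) = lefts M"
  "lefts (M + N) = lefts M \<union> lefts N"
  by (auto simp: lefts_def)

fun signed_prime :: "('f, 'p) signed_fm \<Rightarrow> bool" where
  "signed_prime (Lft A) = prime A"
| "signed_prime (Rgt A) = prime A"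

text \<open>Axiomaticity depends on the sets of prime formulas on each side. This gives weakening and
contraction of leaves and, since principal formulas of logical rules are compound, inversion of
leaves.\<close>

lemma axiomatic_mono:
  assumes "axiomatic l M" "\<And>F. F \<in># M \<Longrightarrow> signed_prime F \<Longrightarrow> F \<in># N"
  shows "axiomatic l N"
  using assms(1) unfolding axiomatic_def
proof
  assume "\<exists>A. Rgt A \<in># M \<and> entails (lefts M) A"
  then obtain A where "Rgt A \<in># M" "entails (lefts M) A" by auto
  moreover from this(2) have "entails (lefts N) A"
    by (rule entails_mono) (use assms(2) in \<open>auto simp: lefts_def\<close>)
  ultimately show "l \<noteq> Minimal \<and> Lft Falsum \<in># N \<or> (\<exists>A. Rgt A \<in># N \<and> entails (lefts N) A)"
    using assms(2) entails_prime by fastforce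
qed (use assms(2) in auto)

lemma axiomatic_entailed:
  assumes "entails (lefts M) A" "axiomatic l (add_mset (Lft A) M)"
  shows "axiomatic l M"
  using assms(2) unfolding axiomatic_def
proof
  assume "l \<noteq> Minimal \<and> Lft Falsum \<in># add_mset (Lft A) M"
  then show "l \<noteq> Minimal \<and> Lft Falsum \<in># M \<or> (\<exists>A. Rgt A \<in># M \<and> entails (lefts M) A)"
    using assms(1) by (auto simp: lefts_def)
next
  assume "\<exists>B. Rgt B \<in># add_mset (Lft A) M \<and> entails (lefts (add_mset (Lft A) M)) B"
  then show "l \<noteq> Minimal \<and> Lft Falsum \<in># M \<or> (\<exists>A. Rgt A \<in># M \<and> entails (lefts M) A)"
    using entails_cut[OF assms(1)] by auto
qed

lemma axiomatic_succedent_cases: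
  "axiomatic l (add_mset (Rgt A) M) \<Longrightarrow> axiomatic l M \<or> entails (lefts M) A"
  by (auto simp: axiomatic_def)

section \<open>Soundness of the equality rules\<close>

text \<open>A replacement on the right is a cut against \<open>P[r], r = s \<Rightarrow> P[s]\<close> and a replacement on the left is a
cut against \<open>P[s], r = s \<Rightarrow> P[r]\<close>, both of which are axiomatic. The set \<open>D\<close> of sequents is abstract
because the lemma is applied both to the axiomatic sequents and to the sequents all of whose instances
are provable in the logical calculus.\<close>

lemma equality_rule_closed:
  assumes mono: "\<And>\<Gamma> \<Delta> \<Gamma>' \<Delta>'. D (\<Gamma> \<turnstile> \<Delta>) \<Longrightarrow> set_mset \<Gamma> \<subseteq> set_mset \<Gamma>' \<Longrightarrow> set_mset \<Delta> \<subseteq> set_mset \<Delta>'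
      \<Longrightarrow> D (\<Gamma>' \<turnstile> \<Delta>')"
    and cut: "\<And>A \<Gamma> \<Delta>. D (\<Gamma> \<turnstile> add_mset A \<Delta>) \<Longrightarrow> D (add_mset A \<Gamma> \<turnstile> \<Delta>) \<Longrightarrow> D (\<Gamma> \<turnstile> \<Delta>)"
    and ax: "\<And>A \<Gamma> \<Delta>. entails (set_mset \<Gamma>) A \<Longrightarrow> D (\<Gamma> \<turnstile> add_mset A \<Delta>)"
    and rule: "\<rho> \<in> {Ref, Rep_r1 Q, Rep_r2 Q, Rep_lplus1 Q, Rep_lplus2 Q}" "(ps, c) \<in> \<rho>"
    and prems: "\<And>p. p \<in> set ps \<Longrightarrow> D p"
  shows "D c"
proof -
  have right: "D (\<Gamma> \<turnstile> add_mset (subst_fm (Free x) s P) \<Delta>)"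
    if prem: "D (\<Gamma> \<turnstile> add_mset (subst_fm (Free x) r P) \<Delta>)"
      and eq: "eqv (equations (set_mset \<Gamma>)) r s" and "atomic P"
    for \<Gamma> \<Delta> r s x P
  proof (rule cut[of _ "subst_fm (Free x) r P"])
    show "D (\<Gamma> \<turnstile> add_mset (subst_fm (Free x) r P) (add_mset (subst_fm (Free x) s P) \<Delta>))"
      using prem by (rule mono) auto
    have "eqv (equations (insert (subst_fm (Free x) r P) (set_mset \<Gamma>))) r s"
      using eq by (rule eqv_closed) (auto simp: equations_def intro: eqv.base)
    then show "D (add_mset (subst_fm (Free x) r P) \<Gamma> \<turnstile> add_mset (subst_fm (Free x) s P) \<Delta>)"
      using \<open>atomic P\<close> by (auto intro!: ax entails_replacement)
  qed
  have left: "D (\<Gamma> \<turnstile> \<Delta>)"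
    if prem: "D (add_mset (subst_fm (Free x) r P) \<Gamma> \<turnstile> \<Delta>)"
      and eq: "eqv (equations (set_mset \<Gamma>)) r s" and "atomic P"
      and mem: "subst_fm (Free x) s P \<in># \<Gamma>"
    for \<Gamma> \<Delta> r s x P
    using _ prem
  proof (rule cut)
    show "D (\<Gamma> \<turnstile> add_mset (subst_fm (Free x) r P) \<Delta>)"
      using eqv.sym[OF eq] mem \<open>atomic P\<close> by (auto intro!: ax entails_replacement)
  qed
  have eq: "eqv (equations (insert (Eq r s) G)) r s" "eqv (equations (insert (Eq s r) G)) r s"
    for r s and G :: "('a, 'b) fm set"
    by (auto simp: equations_def intro: eqv.base eqv.sym)
  have left': "D (add_mset e (add_mset (subst_fm (Free x) s P) \<Gamma>) \<turnstile> \<Delta>)"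
    if "D (\<Gamma>' \<turnstile> \<Delta>)" "e \<in> {Eq r s, Eq s r}" "atomic P"
      and sub: "set_mset \<Gamma>' \<subseteq> {e, subst_fm (Free x) r P, subst_fm (Free x) s P} \<union> set_mset \<Gamma>"
    for e r s x P \<Gamma> \<Delta> \<Gamma>'
  proof (rule left[of x r P _ _ s])
    show "D (add_mset (subst_fm (Free x) r P) (add_mset e (add_mset (subst_fm (Free x) s P) \<Gamma>)) \<turnstile> \<Delta>)"
      using that(1) by (rule mono) (use sub in auto)
    show "eqv (equations (set_mset (add_mset e (add_mset (subst_fm (Free x) s P) \<Gamma>)))) r s"
      using eq[of r s] eq[of s r] that(2) by auto
  qed (simp_all add: \<open>atomic P\<close>)
  consider "\<rho> = Ref" | "(ps, c) \<in> Rep_r1 Q \<union> Rep_r2 Q" | "(ps, c) \<in> Rep_lplus1 Q \<union> Rep_lplus2 Q"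
    using rule by auto
  then show ?thesis
  proof cases
    case 1
    then show ?thesis using rule(2) by (clarsimp simp: Ref_def) (rule ax, simp add: eqv.refl)
  next
    case 2
    then obtain r s x P \<Gamma> \<Delta> e where "c = (add_mset e \<Gamma> \<turnstile> add_mset (subst_fm (Free x) s P) \<Delta>)"
      and "e \<in> {Eq r s, Eq s r}" "atomic P"
      and "ps = [add_mset e \<Gamma> \<turnstile> add_mset (subst_fm (Free x) r P) \<Delta>]"
      unfolding Rep_r1_def Rep_r2_def by blast
    then show ?thesis
      using prems right[of "add_mset e \<Gamma>" x r P \<Delta> s] eq[of r s] eq[of s r] by auto
  next
    case 3
    then show ?thesis
      unfolding Rep_lplus1_def Rep_lplus2_def
    proof (elim UnE CollectE exE conjE)
      fix r s x P \<Gamma> \<Delta>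
      assume "(ps, c) = ([add_mset (Eq r s) (add_mset (subst_fm (Free x) r P) \<Gamma>) \<turnstile> \<Delta>],
        add_mset (Eq r s) (add_mset (subst_fm (Free x) s P) \<Gamma>) \<turnstile> \<Delta>)" "atomic P"
      then show "D c"
        using prems left'[of "add_mset (Eq r s) (add_mset (subst_fm (Free x) r P) \<Gamma>)" \<Delta> "Eq r s" r s P x \<Gamma>]
        by auto
    next
      fix r s x P \<Gamma> \<Delta>
      assume "(ps, c) = ([add_mset (Eq r s) (add_mset (subst_fm (Free x) s P)
          (add_mset (subst_fm (Free x) r P) \<Gamma>)) \<turnstile> \<Delta>],
        add_mset (Eq r s) (add_mset (subst_fm (Free x) s P) \<Gamma>) \<turnstile> \<Delta>)" "equality P"
      then show "D c"
        using prems left'[of "add_mset (Eq r s) (add_mset (subst_fm (Free x) s P)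
          (add_mset (subst_fm (Free x) r P) \<Gamma>))" \<Delta> "Eq r s" r s P x \<Gamma>]
        by (auto simp: atomic_def)
    next
      fix r s x P \<Gamma> \<Delta>
      assume "(ps, c) = ([add_mset (Eq s r) (add_mset (subst_fm (Free x) r P) \<Gamma>) \<turnstile> \<Delta>],
        add_mset (Eq s r) (add_mset (subst_fm (Free x) s P) \<Gamma>) \<turnstile> \<Delta>)" "atomic P"
      then show "D c"
        using prems left'[of "add_mset (Eq s r) (add_mset (subst_fm (Free x) r P) \<Gamma>)" \<Delta> "Eq s r" r s P x \<Gamma>]
        by auto
    next
      fix r s x P \<Gamma> \<Delta>
      assume "(ps, c) = ([add_mset (Eq s r) (add_mset (subst_fm (Free x) s P)
          (add_mset (subst_fm (Free x) r P) \<Gamma>)) \<turnstile> \<Delta>],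
        add_mset (Eq s r) (add_mset (subst_fm (Free x) s P) \<Gamma>) \<turnstile> \<Delta>)" "equality P"
      then show "D c"
        using prems left'[of "add_mset (Eq s r) (add_mset (subst_fm (Free x) s P)
          (add_mset (subst_fm (Free x) r P) \<Gamma>))" \<Delta> "Eq s r" r s P x \<Gamma>]
        by (auto simp: atomic_def)
    qed
  qed
qed

lemma axiomatic_initial:
  assumes "\<rho> \<in> initial l" "(ps, c) \<in> \<rho>"
  shows "axiomatic l (signed c)"
proof -
  from assms(1) consider "\<rho> = Init" | "\<rho> = Init_bot" | "\<rho> = L_bot" "l \<noteq> Minimal"
    by (cases l) auto
  then show ?thesis
  proof cases
    case 1
    then obtain P \<Gamma> \<Delta> where "c = (add_mset P \<Gamma> \<turnstile> add_mset P \<Delta>)" "prime P"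
      using assms(2) by (auto simp: Init_def prime_def)
    then show ?thesis using entails_member[of P "insert P (set_mset \<Gamma>)"]
      by (auto simp: axiomatic_signed simp del: signed.simps)
  next
    case 2
    then show ?thesis using assms(2)
      by (auto simp: Init_bot_def axiomatic_signed simp del: signed.simps intro!: exI[of _ Falsum])
  next
    case 3
    then show ?thesis using assms(2)
      by (auto simp: L_bot_def axiomatic_signed simp del: signed.simps)
  qed
qed

lemma axiomatic_sound:
  assumes rules: "C \<subseteq> initial l \<union> (\<Union>Q. {Ref, Rep_r1 Q, Rep_r2 Q, Rep_lplus1 Q, Rep_lplus2 Q})"
    and "derivable S C s"
  shows "axiomatic l (signed s)"
  using assms(2)
proof (induction rule: derivable.induct)
  case (step \<rho> ps c)
  from rules step.hyps(1) consider "\<rho> \<in> initial l"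
    | Q where "\<rho> \<in> {Ref, Rep_r1 Q, Rep_r2 Q, Rep_lplus1 Q, Rep_lplus2 Q}"
    by blast
  then show ?case
  proof cases
    case 1
    then show ?thesis using step.hyps(2) by (rule axiomatic_initial)
  next
    case 2
    show ?thesis
    proof (rule equality_rule_closed[where D = "\<lambda>s. axiomatic l (signed s)", OF _ _ _ 2 step.hyps(2)])
      fix \<Gamma> \<Delta> \<Gamma>' \<Delta>' :: "('a, 'b) fm multiset"
      assume "axiomatic l (signed (\<Gamma> \<turnstile> \<Delta>))"
        and sub: "set_mset \<Gamma> \<subseteq> set_mset \<Gamma>'" "set_mset \<Delta> \<subseteq> set_mset \<Delta>'"
      from this(1) show "axiomatic l (signed (\<Gamma>' \<turnstile> \<Delta>'))"
        by (rule axiomatic_mono) (use sub in auto)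
    next
      fix A and \<Gamma> \<Delta> :: "('a, 'b) fm multiset"
      assume "axiomatic l (signed (\<Gamma> \<turnstile> add_mset A \<Delta>))" "axiomatic l (signed (add_mset A \<Gamma> \<turnstile> \<Delta>))"
      then have "axiomatic l (add_mset (Rgt A) (signed (\<Gamma> \<turnstile> \<Delta>)))"
        and A: "axiomatic l (add_mset (Lft A) (signed (\<Gamma> \<turnstile> \<Delta>)))"
        by simp_all
      then show "axiomatic l (signed (\<Gamma> \<turnstile> \<Delta>))"
        using axiomatic_succedent_cases axiomatic_entailed by blast
    next
      fix A and \<Gamma> \<Delta> :: "('a, 'b) fm multiset"
      assume "entails (set_mset \<Gamma>) A"
      then show "axiomatic l (signed (\<Gamma> \<turnstile> add_mset A \<Delta>))"
        unfolding axiomatic_signed by auto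
    qed (use step.IH in blast)
  qed
qed

section \<open>Confluence of rewriting with saturated equations\<close>

text \<open>One replacement of one occurrence; \<open>(s, r)\<close> stands for the rule that replaces \<open>s\<close> by \<open>r\<close>.\<close>

inductive reduces :: "('f tm \<times> 'f tm) set \<Rightarrow> 'f tm \<Rightarrow> 'f tm \<Rightarrow> bool" for R where
  root: "(s, r) \<in> R \<Longrightarrow> reduces R s r"
| arg: "i < length ts \<Longrightarrow> reduces R (ts ! i) u \<Longrightarrow> reduces R (Fn f ts) (Fn f (ts[i := u]))"

text \<open>The direction in which the restricted rules can use an equality, read from conclusion to premiss: a
shortening application of the first rules turns \<open>b\<close> into \<open>a\<close>, a nonlengthening application of the
second rules turns \<open>a\<close> into \<open>b\<close>, and exactly one of the two is possible.\<close>

definition orient :: "('f tm \<Rightarrow> 'f tm \<Rightarrow> bool) \<Rightarrow> 'f tm \<times> 'f tm \<Rightarrow> 'f tm \<times> 'f tm" where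
  "orient prec = (\<lambda>(a, b). if prec a b then (b, a) else (a, b))"

text \<open>The equalities that the left rules can add to an antecedent containing \<open>E\<close>. An equality must not
rewrite itself: the left rules need the operating equality beside the rewritten one, and the antecedent
may contain a single copy.\<close>

inductive_set saturation ::
  "('f tm \<Rightarrow> 'f tm \<Rightarrow> bool) \<Rightarrow> ('f tm \<times> 'f tm) set \<Rightarrow> ('f tm \<times> 'f tm) set"
  for prec E where
  base: "e \<in> E \<Longrightarrow> e \<in> saturation prec E"
| left: "(a, b) \<in> saturation prec E \<Longrightarrow> e \<in> saturation prec E \<Longrightarrow> e \<noteq> (a, b)
    \<Longrightarrow> reduces {orient prec e} a a' \<Longrightarrow> (a', b) \<in> saturation prec E"
| right: "(a, b) \<in> saturation prec E \<Longrightarrow> e \<in> saturation prec E \<Longrightarrow> e \<noteq> (a, b)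
    \<Longrightarrow> reduces {orient prec e} b b' \<Longrightarrow> (a, b') \<in> saturation prec E"

lemma reduces_single: "reduces R t t' \<Longrightarrow> \<exists>\<rho>\<in>R. reduces {\<rho>} t t'"
  by (induction rule: reduces.induct) (auto intro: reduces.intros)

lemma size_nth_less: "i < length ts \<Longrightarrow> size (ts ! i) < size (Fn f ts)"
  using size_list_estimation'[OF nth_mem[of i ts] order_refl, of size] by simp

lemma reduces_size:
  "reduces {(s, r)} t t' \<Longrightarrow> size s \<le> size t"
proof (induction rule: reduces.induct)
  case (arg i ts u f)
  then show ?case using size_nth_less[of i ts f] by simp
qed simp

text \<open>A term contains no second occurrence of itself. This is what makes it harmless that saturation never
rewrites an equality with itself.\<close>

lemma reduces_lhs: "reduces {(s, r)} s t \<Longrightarrow> t = r"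
proof (cases rule: reduces.cases, assumption)
  fix i ts u f
  assume "s = Fn f ts" "i < length ts" "reduces {(s, r)} (ts ! i) u"
  then show "t = r" using reduces_size[of s r "ts ! i" u] size_nth_less[of i ts f] by simp
qed auto

text \<open>The rule \<open>s \<rightarrow> r\<close> comes from an equality between \<open>s\<close> and \<open>r\<close>; rewriting its side \<open>s\<close> to \<open>t\<close> yields a
saturated equality between \<open>t\<close> and \<open>r\<close>. Its orientation is unknown, but either orientation relates
\<open>t\<close> and \<open>r\<close> by one step.\<close>

lemma saturated_critical_pair:
  assumes "e \<in> saturation prec E" "e' \<in> saturation prec E"
    and e: "orient prec e = (s, r)" and t: "reduces {orient prec e'} s t"
  shows "t = r \<or> reduces (orient prec ` saturation prec E) t r
    \<or> reduces (orient prec ` saturation prec E) r t"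
proof (cases "e' = e")
  case True
  then show ?thesis using e t reduces_lhs by metis
next
  case False
  have "(t, r) \<in> saturation prec E \<or> (r, t) \<in> saturation prec E"
  proof (cases "e = (s, r)")
    case True
    then show ?thesis using assms False saturation.left[of s r prec E e' t] by simp
  next
    case swapped: False
    then have "e = (r, s)"
      using e by (cases e) (auto simp: orient_def split: if_splits)
    then show ?thesis using assms False saturation.right[of r s prec E e' t] by simp
  qed
  then obtain d where "d \<in> saturation prec E" "d \<in> {(t, r), (r, t)}" by blast
  moreover from this(2) have "orient prec d \<in> {(t, r), (r, t)}" by (auto simp: orient_def)
  ultimately have "(t, r) \<in> orient prec ` saturation prec E \<or> (r, t) \<in> orient prec ` saturation prec E"
    by (metis image_eqI insertE singletonD)
  then show ?thesis by (auto intro: reduces.root)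
qed

text \<open>Steps in disjoint subterms commute, and overlapping steps have a critical pair at the position of the
outer one. The relation is thus confluent in one step, up to reflexivity, and this implies confluence
also for rewrite relations that do not terminate.\<close>

lemma saturated_peak:
  fixes prec :: "'f tm \<Rightarrow> 'f tm \<Rightarrow> bool" and E
  defines "R \<equiv> orient prec ` saturation prec E"
  assumes "reduces R t t1" "reduces R t t2"
  shows "t1 = t2 \<or> reduces R t1 t2 \<or> reduces R t2 t1 \<or> (\<exists>v. reduces R t1 v \<and> reduces R t2 v)"
proof -
  have root_peak: "t2 = r \<or> reduces R t2 r \<or> reduces R r t2"
    if st: "reduces R s t2" and sr: "(s, r) \<in> R" for s r t2
  proof -
    obtain e e' where "e \<in> saturation prec E" "e' \<in> saturation prec E"
      "orient prec e = (s, r)" "reduces {orient prec e'} s t2"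
      using sr reduces_single[OF st] by (auto simp: R_def)
    then show ?thesis unfolding R_def by (rule saturated_critical_pair)
  qed
  show ?thesis
    using assms(2,3)
  proof (induction arbitrary: t2 rule: reduces.induct)
    case (root s r)
    then show ?case using root_peak by blast
  next
    case (arg i ts u f)
    from arg.prems show ?case
    proof (cases rule: reduces.cases)
      case root
      have "reduces R (Fn f ts) (Fn f (ts[i := u]))" using arg.hyps by (rule reduces.arg)
      then show ?thesis using root_peak root by blast
    next
      case (arg j w)
      note j = this
      show ?thesis
      proof (cases "i = j")
        case True
        have "u = w \<or> reduces R u w \<or> reduces R w u \<or> (\<exists>v. reduces R u v \<and> reduces R w v)"
          using arg.IH j True by blast
        moreover have "reduces R (Fn f (ts[i := x])) (Fn f (ts[i := y]))" if "reduces R x y" for x y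
          using reduces.arg[of i "ts[i := x]" R y f] that arg.hyps(1) by simp
        ultimately show ?thesis using j True by blast
      next
        case False
        have "reduces R (Fn f (ts[i := u])) (Fn f (ts[i := u, j := w]))"
          using reduces.arg[of j "ts[i := u]" R w f] j False by simp
        moreover have "reduces R (Fn f (ts[j := w])) (Fn f (ts[i := u, j := w]))"
          using reduces.arg[of i "ts[j := w]" R u f] arg.hyps False
          by (simp add: list_update_swap)
        ultimately show ?thesis using j by blast
      qed
    qed
  qed
qed

lemma saturated_confluent:
  "confluentp (reduces (orient prec ` saturation prec E))"
  by (rule strong_confluentp_imp_confluentp, rule strong_confluentpI) (use saturated_peak in blast)

definition list_step :: "('a \<Rightarrow> 'a \<Rightarrow> bool) \<Rightarrow> 'a list \<Rightarrow> 'a list \<Rightarrow> bool" where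
  "list_step Q ts us \<longleftrightarrow> (\<exists>i u. i < length ts \<and> Q (ts ! i) u \<and> us = ts[i := u])"

lemma list_steps:
  assumes "list_all2 Q\<^sup>*\<^sup>* ts us"
  shows "(list_step Q)\<^sup>*\<^sup>* ts us"
  using assms
proof (induction rule: list_all2_induct)
  case (Cons t ts u us)
  have "(list_step Q)\<^sup>*\<^sup>* (t # ts) (u # ts)"
    using Cons.hyps(1)
  proof (induction rule: rtranclp_induct)
    case (step v w)
    have "list_step Q (v # ts) (w # ts)"
      unfolding list_step_def using step.hyps(2) by (intro exI[of _ 0] exI[of _ w]) simp
    with step.IH show ?case by simp
  qed simp
  also have "(list_step Q)\<^sup>*\<^sup>* (u # ts) (u # us)"
    using Cons.IH
  proof (induction rule: rtranclp_induct)
    case (step vs ws)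
    then obtain i w where "i < length vs" "Q (vs ! i) w" "ws = vs[i := w]"
      by (auto simp: list_step_def)
    then have "list_step Q (u # vs) (u # ws)"
      unfolding list_step_def by (intro exI[of _ "Suc i"] exI[of _ w]) simp
    with step.IH show ?case by simp
  qed simp
  finally show ?case .
qed simp

lemma equivclp_Fn:
  assumes "list_all2 (equivclp (reduces R)) ts us"
  shows "equivclp (reduces R) (Fn f ts) (Fn f us)"
proof -
  have "(list_step (symclp (reduces R)))\<^sup>*\<^sup>* ts us"
    using assms by (intro list_steps) (simp add: equivclp_def)
  then show ?thesis
  proof (induction rule: rtranclp_induct)
    case (step vs ws)
    then obtain i w where i: "i < length vs" "symclp (reduces R) (vs ! i) w" "ws = vs[i := w]"
      by (auto simp: list_step_def)
    from i(2) have "reduces R (Fn f vs) (Fn f ws) \<or> reduces R (Fn f ws) (Fn f vs)"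
    proof (cases rule: symclpE)
      case base
      then show ?thesis using i by (auto intro: reduces.arg)
    next
      case sym
      then have "reduces R (Fn f ws) (Fn f (ws[i := vs ! i]))"
        using i by (intro reduces.arg) auto
      then show ?thesis using i by simp
    qed
    with step.IH show ?case by (rule equivclp_into_equivclp)
  qed simp
qed

text \<open>The set \<open>R\<close> may contain an equation in either direction: it is the symmetric closure of \<open>E\<close> for the
unrestricted calculus and a set of oriented equations for the restricted one.\<close>

lemma eqv_equivclp:
  assumes "eqv E t u" "\<And>a b. (a, b) \<in> E \<Longrightarrow> (a, b) \<in> R \<or> (b, a) \<in> R"
  shows "equivclp (reduces R) t u"
  using assms(1)
proof induction
  case (base t u)
  then show ?case using assms(2)[OF base] by (auto intro: reduces.root)
next
  case (refl t)
  show ?case by simp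
next
  case (sym t u)
  from sym.IH show ?case by (rule equivclp_sym)
next
  case (trans t u v)
  from trans.IH show ?case by (rule equivclp_trans)
next
  case (cong ts us f)
  have "list_all2 (equivclp (reduces R)) ts us"
    using cong.IH by (rule list_all2_mono) simp
  then show ?case by (rule equivclp_Fn)
qed

lemma saturated_join:
  assumes "eqv E t u"
  shows "\<exists>v. (reduces (orient prec ` saturation prec E))\<^sup>*\<^sup>* t v
    \<and> (reduces (orient prec ` saturation prec E))\<^sup>*\<^sup>* u v"
proof -
  let ?R = "orient prec ` saturation prec E"
  have "equivclp (reduces ?R) t u"
    using assms
  proof (rule eqv_equivclp)
    fix a b
    assume "(a, b) \<in> E"
    then have "orient prec (a, b) \<in> ?R" by (intro imageI saturation.base)
    then show "(a, b) \<in> ?R \<or> (b, a) \<in> ?R" by (auto simp: orient_def split: if_splits)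
  qed
  moreover have "semiconfluentp (reduces ?R)"
    using saturated_confluent by (rule confluentp_imp_semiconfluentp)
  ultimately show ?thesis
    by (auto simp: semiconfluentp_equivclp rtranclp_conversep)
qed

section \<open>Completeness of the equality rules\<close>

inductive atom_reduces :: "('f tm \<times> 'f tm) set \<Rightarrow> ('f, 'p) fm \<Rightarrow> ('f, 'p) fm \<Rightarrow> bool" for R where
  "reduces R t t' \<Longrightarrow> atom_reduces R (Eq t u) (Eq t' u)"
| "reduces R u u' \<Longrightarrow> atom_reduces R (Eq t u) (Eq t u')"
| "list_step (reduces R) ts us \<Longrightarrow> atom_reduces R (Pred p ts) (Pred p us)"

lemma atom_reduces_single:
  assumes "atom_reduces R F F'"
  shows "\<exists>\<rho>\<in>R. atom_reduces {\<rho>} F F'"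
  using assms
proof cases
  case (3 ts us p)
  then obtain i u where i: "i < length ts" "reduces R (ts ! i) u" "us = ts[i := u]"
    by (auto simp: list_step_def)
  then obtain \<rho> where \<rho>: "\<rho> \<in> R" "reduces {\<rho>} (ts ! i) u"
    using reduces_single by blast
  then have "list_step (reduces {\<rho>}) ts us"
    using i unfolding list_step_def by blast
  then show ?thesis
    using \<rho>(1) 3(1,2) by (auto intro: atom_reduces.intros)
qed (use reduces_single in \<open>blast intro: atom_reduces.intros\<close>)+

lemma finite_fv_tm [simp]: "finite (fv_tm t)"
proof (induction t)
  case (Var v)
  then show ?case by (cases v) auto
qed auto

lemma subst_tm_fresh: "x \<notin> fv_tm t \<Longrightarrow> subst_tm (Free x) s t = t"
proof (induction t)
  case (Var v)
  then show ?case by (cases v) auto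
qed (auto intro: map_idI)

text \<open>The replacement rules are stated by substitution for a variable, so a rewrite step has to be
presented with a variable in place of the redex. The variable must avoid the other arguments of the
surrounding atom, hence the set \<open>X\<close>.\<close>

lemma reduces_context:
  assumes "reduces {(s, r)} t t'" "finite X"
  shows "\<exists>x c. x \<notin> X \<and> t = subst_tm (Free x) s c \<and> t' = subst_tm (Free x) r c"
  using assms
proof (induction arbitrary: X rule: reduces.induct)
  case (root s' r')
  obtain x where "x \<notin> X" using ex_new_if_finite[OF infinite_UNIV_nat root(2)] by blast
  then show ?case using root by (intro exI[of _ x] exI[of _ "Var (Free x)"]) simp
next
  case (arg i ts u f)
  then obtain x c where x: "x \<notin> X \<union> fv_tm (Fn f ts)"
    and c: "ts ! i = subst_tm (Free x) s c" "u = subst_tm (Free x) r c"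
    using arg.IH[of "X \<union> fv_tm (Fn f ts)"] by fastforce
  have fresh: "map (subst_tm (Free x) q) ts = ts" for q
    by (rule map_idI) (use x subst_tm_fresh in auto)
  show ?case
    using x arg.hyps by (intro exI[of _ x] exI[of _ "Fn f (ts[i := c])"])
      (simp add: map_update fresh flip: c)
qed

lemma atom_reduces_context:
  assumes "atom_reduces {(s, r)} F F'"
  shows "\<exists>x P. atomic P \<and> equality P = equality F
    \<and> F = subst_fm (Free x) s P \<and> F' = subst_fm (Free x) r P"
  using assms
proof cases
  case (1 t t' u)
  obtain x c where "x \<notin> fv_tm u" "t = subst_tm (Free x) s c" "t' = subst_tm (Free x) r c"
    using reduces_context[OF 1(3), of "fv_tm u"] by auto
  then show ?thesis
    using 1 by (intro exI[of _ x] exI[of _ "Eq c u"]) (simp add: atomic_def equality_def subst_tm_fresh)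
next
  case (2 u u' t)
  obtain x c where "x \<notin> fv_tm t" "u = subst_tm (Free x) s c" "u' = subst_tm (Free x) r c"
    using reduces_context[OF 2(3), of "fv_tm t"] by auto
  then show ?thesis
    using 2 by (intro exI[of _ x] exI[of _ "Eq t c"]) (simp add: atomic_def equality_def subst_tm_fresh)
next
  case (3 ts us p)
  then obtain i u where i: "i < length ts" "reduces {(s, r)} (ts ! i) u" "us = ts[i := u]"
    by (auto simp: list_step_def)
  obtain x c where x: "x \<notin> (\<Union>t\<in>set ts. fv_tm t)"
    and c: "ts ! i = subst_tm (Free x) s c" "u = subst_tm (Free x) r c"
    using reduces_context[OF i(2), of "\<Union>t\<in>set ts. fv_tm t"] by auto
  have fresh: "map (subst_tm (Free x) q) ts = ts" for q
    by (rule map_idI) (use x subst_tm_fresh in auto)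
  show ?thesis
    using 3(1,2) i(1,3) by (intro exI[of _ x] exI[of _ "Pred p (ts[i := c])"])
      (simp add: map_update fresh atomic_def equality_def flip: c)
qed

lemma reduces_wf:
  assumes "reduces {(s, r)} t t'" "is_term S r" "is_term S t"
  shows "is_term S t'"
  using assms
proof (induction rule: reduces.induct)
  case (arg i ts u f)
  then show ?case by (auto simp: is_term_def dest!: subsetD[OF set_update_subset_insert])
qed simp

lemma atom_reduces_wf:
  assumes "atom_reduces {(s, r)} F F'" "is_term S r" "is_formula S F"
  shows "is_formula S F'"
  using assms(1)
proof cases
  case (3 ts us p)
  then obtain i u where i: "i < length ts" "reduces {(s, r)} (ts ! i) u" "us = ts[i := u]"
    by (auto simp: list_step_def)
  then have "wf_tm S {} u"
    using reduces_wf[of s r "ts ! i" u S] assms 3 by (simp add: is_term_def is_formula_def)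
  then show ?thesis
    using assms 3 i by (auto simp: is_formula_def dest!: subsetD[OF set_update_subset_insert])
qed (use assms reduces_wf[of s r _ _ S] in \<open>auto simp: is_term_def is_formula_def\<close>)

lemma is_sequent_iff:
  "is_sequent S (\<Gamma> \<turnstile> \<Delta>) \<longleftrightarrow> (\<forall>F\<in>#\<Gamma>. is_formula S F) \<and> (\<forall>F\<in>#\<Delta>. is_formula S F)"
  by (auto simp: is_sequent_def)

lemma derivable_is_sequent: "derivable S C s \<Longrightarrow> is_sequent S s"
  by (auto elim: derivable.cases)

lemma derivable_single:
  "derivable S C p \<Longrightarrow> \<rho> \<in> C \<Longrightarrow> ([p], c) \<in> \<rho> \<Longrightarrow> is_sequent S c \<Longrightarrow> derivable S C c"
  by (rule derivable.step) auto

lemma derivable_double: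
  "derivable S C p \<Longrightarrow> derivable S C q \<Longrightarrow> \<rho> \<in> C \<Longrightarrow> ([p, q], c) \<in> \<rho> \<Longrightarrow> is_sequent S c
    \<Longrightarrow> derivable S C c"
  by (rule derivable.step) auto

lemma derivable_initial: "\<rho> \<in> C \<Longrightarrow> ([], c) \<in> \<rho> \<Longrightarrow> is_sequent S c \<Longrightarrow> derivable S C c"
  by (rule derivable.step) auto

lemma Rep_right_instances:
  assumes "atomic P" "Q r s"
  shows "([add_mset (Eq r s) \<Gamma> \<turnstile> add_mset (subst_fm (Free x) r P) \<Delta>],
      add_mset (Eq r s) \<Gamma> \<turnstile> add_mset (subst_fm (Free x) s P) \<Delta>) \<in> Rep_r1 Q"
    and "([add_mset (Eq s r) \<Gamma> \<turnstile> add_mset (subst_fm (Free x) r P) \<Delta>],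
      add_mset (Eq s r) \<Gamma> \<turnstile> add_mset (subst_fm (Free x) s P) \<Delta>) \<in> Rep_r2 Q"
  using assms unfolding Rep_r1_def Rep_r2_def by blast+

lemma Rep_left_instances:
  assumes "atomic P" "Q r s"
  shows "([add_mset (Eq r s) (if equality P
        then add_mset (subst_fm (Free x) s P) (add_mset (subst_fm (Free x) r P) \<Gamma>)
        else add_mset (subst_fm (Free x) r P) \<Gamma>) \<turnstile> \<Delta>],
      add_mset (Eq r s) (add_mset (subst_fm (Free x) s P) \<Gamma>) \<turnstile> \<Delta>) \<in> Rep_lplus1 Q"
    and "([add_mset (Eq s r) (if equality P
        then add_mset (subst_fm (Free x) s P) (add_mset (subst_fm (Free x) r P) \<Gamma>)
        else add_mset (subst_fm (Free x) r P) \<Gamma>) \<turnstile> \<Delta>],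
      add_mset (Eq s r) (add_mset (subst_fm (Free x) s P) \<Gamma>) \<turnstile> \<Delta>) \<in> Rep_lplus2 Q"
  using assms unfolding Rep_lplus1_def Rep_lplus2_def 
  by (cases "equality P"; simp only: if_True if_False; blast)+

lemma replace_right:
  assumes rule: "Rep_r1 Q1 \<in> C \<and> Q1 r s \<and> Eq r s \<in># \<Gamma> \<or> Rep_r2 Q2 \<in> C \<and> Q2 r s \<and> Eq s r \<in># \<Gamma>"
    and red: "atom_reduces {(s, r)} F F'"
    and wf: "is_sequent S (\<Gamma> \<turnstile> add_mset F \<Delta>)"
    and der: "derivable S C (\<Gamma> \<turnstile> add_mset F' \<Delta>)"
  shows "derivable S C (\<Gamma> \<turnstile> add_mset F \<Delta>)"
proof -
  obtain x P where P: "atomic P" "F = subst_fm (Free x) s P" "F' = subst_fm (Free x) r P"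
    using atom_reduces_context[OF red] by blast
  from rule show ?thesis
  proof (elim disjE conjE)
    assume "Rep_r1 Q1 \<in> C" "Q1 r s" "Eq r s \<in># \<Gamma>"
    moreover obtain \<Gamma>' where "\<Gamma> = add_mset (Eq r s) \<Gamma>'"
      using \<open>Eq r s \<in># \<Gamma>\<close> by (metis mset_add)
    ultimately show ?thesis
      using derivable_single[OF der] Rep_right_instances(1)[of P Q1 r s \<Gamma>' x \<Delta>] P wf by blast
  next
    assume "Rep_r2 Q2 \<in> C" "Q2 r s" "Eq s r \<in># \<Gamma>"
    moreover obtain \<Gamma>' where "\<Gamma> = add_mset (Eq s r) \<Gamma>'"
      using \<open>Eq s r \<in># \<Gamma>\<close> by (metis mset_add)
    ultimately show ?thesis
      using derivable_single[OF der] Rep_right_instances(2)[of P Q2 r s \<Gamma>' x \<Delta>] P wf by blast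
  qed
qed

lemma replace_left:
  assumes rule: "Rep_lplus1 Q1 \<in> C \<and> Q1 r s \<and> e = Eq r s \<or> Rep_lplus2 Q2 \<in> C \<and> Q2 r s \<and> e = Eq s r"
    and red: "atom_reduces {(s, r)} F F'"
    and wf: "is_sequent S (add_mset e (add_mset F \<Gamma>) \<turnstile> \<Delta>)"
    and der: "derivable S C (add_mset e (if equality F then add_mset F (add_mset F' \<Gamma>) else add_mset F' \<Gamma>) \<turnstile> \<Delta>)"
  shows "derivable S C (add_mset e (add_mset F \<Gamma>) \<turnstile> \<Delta>)"
proof -
  obtain x P where P: "atomic P" "equality P = equality F"
    "F = subst_fm (Free x) s P" "F' = subst_fm (Free x) r P"
    using atom_reduces_context[OF red] by blast
  from rule show ?thesis
  proof (elim disjE conjE)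
    assume Q: "Rep_lplus1 Q1 \<in> C" "Q1 r s" "e = Eq r s"
    show ?thesis
      using der Q(1) _ wf
    proof (rule derivable_single)
      show "([add_mset e (if equality F then add_mset F (add_mset F' \<Gamma>) else add_mset F' \<Gamma>) \<turnstile> \<Delta>],
        add_mset e (add_mset F \<Gamma>) \<turnstile> \<Delta>) \<in> Rep_lplus1 Q1"
        using Rep_left_instances(1)[of P Q1 r s x \<Gamma> \<Delta>] P(1) Q(2,3)
        by (simp only: P(2) flip: P(3,4))
    qed
  next
    assume Q: "Rep_lplus2 Q2 \<in> C" "Q2 r s" "e = Eq s r"
    show ?thesis
      using der Q(1) _ wf
    proof (rule derivable_single)
      show "([add_mset e (if equality F then add_mset F (add_mset F' \<Gamma>) else add_mset F' \<Gamma>) \<turnstile> \<Delta>],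
        add_mset e (add_mset F \<Gamma>) \<turnstile> \<Delta>) \<in> Rep_lplus2 Q2"
        using Rep_left_instances(2)[of P Q2 r s x \<Gamma> \<Delta>] P(1) Q(2,3)
        by (simp only: P(2) flip: P(3,4))
    qed
  qed
qed

definition formulas :: "('f, 'p) signature \<Rightarrow> ('f, 'p) fm multiset \<Rightarrow> bool" where
  "formulas S \<Gamma> \<longleftrightarrow> (\<forall>F\<in>#\<Gamma>. is_formula S F)"

lemma formulas_simps [simp]:
  "formulas S {#}" "formulas S (add_mset A \<Gamma>) \<longleftrightarrow> is_formula S A \<and> formulas S \<Gamma>"
  by (auto simp: formulas_def)

lemma is_sequent_formulas: "is_sequent S (\<Gamma> \<turnstile> \<Delta>) \<longleftrightarrow> formulas S \<Gamma> \<and> formulas S \<Delta>"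
  by (simp add: is_sequent_iff formulas_def)

definition contains_equations :: "('f tm \<times> 'f tm) set \<Rightarrow> ('f, 'p) fm multiset \<Rightarrow> bool" where
  "contains_equations E \<Gamma> \<longleftrightarrow> (\<forall>(a, b)\<in>E. Eq a b \<in># \<Gamma>)"

lemma contains_equations_mono:
  "contains_equations E \<Gamma> \<Longrightarrow> \<Gamma> \<subseteq># \<Gamma>' \<Longrightarrow> contains_equations E \<Gamma>'"
  unfolding contains_equations_def using mset_subset_eqD by fastforce

lemma orient_rule:
  assumes "orient prec (a, b) = (s, r)"
  shows "shortening prec r s \<and> Eq a b = Eq r s \<or> nonlengthening prec r s \<and> Eq a b = Eq s r"
  using assms by (auto simp: orient_def shortening_def nonlengthening_def split: if_splits)

text \<open>The left rule for equalities keeps the formula that it rewrites, so that the antecedent only grows.\<close>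

lemma saturation_step:
  assumes C: "R12_rlplus_prec prec \<subseteq> C"
    and \<Gamma>: "formulas S \<Gamma>" "Eq a b \<in># \<Gamma>" "Eq c d \<in># \<Gamma>" "(c, d) \<noteq> (a, b)"
    and red: "atom_reduces {orient prec (c, d)} (Eq a b) F"
  shows "is_formula S F \<and>
    (derivable S C (add_mset F \<Gamma> \<turnstile> \<Delta>) \<longrightarrow> derivable S C (\<Gamma> \<turnstile> \<Delta>))"
proof -
  obtain s r where sr: "orient prec (c, d) = (s, r)" by fastforce
  have red: "atom_reduces {(s, r)} (Eq a b) F" using red sr by simp
  have "is_formula S (Eq c d)" using \<Gamma> by (auto simp: formulas_def)
  then have "is_term S r"
    using sr by (auto simp: orient_def is_formula_def is_term_def split: if_splits)
  then have F: "is_formula S F"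
    using atom_reduces_wf[OF red] \<Gamma> by (auto simp: formulas_def)
  obtain \<Gamma>1 where "\<Gamma> = add_mset (Eq c d) \<Gamma>1" using \<Gamma>(3) by (metis mset_add)
  \<comment> \<open>The two equalities differ as formulas, so one remains when the other is set aside.\<close>
  moreover from this have "Eq a b \<in># \<Gamma>1" using \<Gamma>(2,4) by auto
  then obtain \<Gamma>2 where "\<Gamma>1 = add_mset (Eq a b) \<Gamma>2" by (metis mset_add)
  ultimately have eq: "\<Gamma> = add_mset (Eq c d) (add_mset (Eq a b) \<Gamma>2)" by simp
  have "derivable S C (\<Gamma> \<turnstile> \<Delta>)" if der: "derivable S C (add_mset F \<Gamma> \<turnstile> \<Delta>)"
    unfolding eq
  proof (rule replace_left[OF _ red])
    show "Rep_lplus1 (shortening prec) \<in> C \<and> shortening prec r s \<and> Eq c d = Eq r s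
      \<or> Rep_lplus2 (nonlengthening prec) \<in> C \<and> nonlengthening prec r s \<and> Eq c d = Eq s r"
      using orient_rule[OF sr] C by (auto simp: R12_rlplus_prec_def)
    show "is_sequent S (add_mset (Eq c d) (add_mset (Eq a b) \<Gamma>2) \<turnstile> \<Delta>)"
      using derivable_is_sequent[OF der] \<Gamma>(1) eq by (simp add: is_sequent_formulas)
    show "derivable S C (add_mset (Eq c d) (if equality (Eq a b)
        then add_mset (Eq a b) (add_mset F \<Gamma>2) else add_mset F \<Gamma>2) \<turnstile> \<Delta>)"
      using der by (simp add: eq equality_def add_mset_commute)
  qed
  then show ?thesis using F by blast
qed

text \<open>Finitely many applications of the left rules make any given saturated equality available, keeping
everything that was in the antecedent.\<close>

lemma saturation_available:
  assumes "e \<in> saturation prec E" and C: "R12_rlplus_prec prec \<subseteq> C"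
    and "formulas S \<Gamma>" "contains_equations E \<Gamma>"
  shows "\<exists>\<Gamma>'. \<Gamma> \<subseteq># \<Gamma>' \<and> formulas S \<Gamma>' \<and> Eq (fst e) (snd e) \<in># \<Gamma>'
    \<and> (\<forall>\<Delta>. derivable S C (\<Gamma>' \<turnstile> \<Delta>) \<longrightarrow> derivable S C (\<Gamma> \<turnstile> \<Delta>))"
proof -
  have extend: "\<exists>\<Gamma>'. \<Gamma> \<subseteq># \<Gamma>' \<and> formulas S \<Gamma>' \<and> F \<in># \<Gamma>'
    \<and> (\<forall>\<Delta>. derivable S C (\<Gamma>' \<turnstile> \<Delta>) \<longrightarrow> derivable S C (\<Gamma> \<turnstile> \<Delta>))"
    if IH: "\<And>\<Gamma>. formulas S \<Gamma> \<Longrightarrow> contains_equations E \<Gamma> \<Longrightarrow>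
        \<exists>\<Gamma>'. \<Gamma> \<subseteq># \<Gamma>' \<and> formulas S \<Gamma>' \<and> Eq a b \<in># \<Gamma>'
          \<and> (\<forall>\<Delta>. derivable S C (\<Gamma>' \<turnstile> \<Delta>) \<longrightarrow> derivable S C (\<Gamma> \<turnstile> \<Delta>))"
      "\<And>\<Gamma>. formulas S \<Gamma> \<Longrightarrow> contains_equations E \<Gamma> \<Longrightarrow>
        \<exists>\<Gamma>'. \<Gamma> \<subseteq># \<Gamma>' \<and> formulas S \<Gamma>' \<and> Eq (fst e) (snd e) \<in># \<Gamma>'
          \<and> (\<forall>\<Delta>. derivable S C (\<Gamma>' \<turnstile> \<Delta>) \<longrightarrow> derivable S C (\<Gamma> \<turnstile> \<Delta>))"
      and \<Gamma>: "formulas S \<Gamma>" "contains_equations E \<Gamma>"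
      and e: "e \<noteq> (a, b)" "atom_reduces {orient prec e} (Eq a b) F"
    for a b e F and \<Gamma> :: "('a, 'b) fm multiset"
  proof -
    obtain \<Gamma>1 where 1: "\<Gamma> \<subseteq># \<Gamma>1" "formulas S \<Gamma>1" "Eq a b \<in># \<Gamma>1"
      "\<And>\<Delta>. derivable S C (\<Gamma>1 \<turnstile> \<Delta>) \<Longrightarrow> derivable S C (\<Gamma> \<turnstile> \<Delta>)"
      using IH(1)[OF \<Gamma>] by blast
    obtain \<Gamma>2 where 2: "\<Gamma>1 \<subseteq># \<Gamma>2" "formulas S \<Gamma>2" "Eq (fst e) (snd e) \<in># \<Gamma>2"
      "\<And>\<Delta>. derivable S C (\<Gamma>2 \<turnstile> \<Delta>) \<Longrightarrow> derivable S C (\<Gamma>1 \<turnstile> \<Delta>)"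
      using IH(2)[OF 1(2) contains_equations_mono[OF \<Gamma>(2) 1(1)]] by blast
    have ab: "Eq a b \<in># \<Gamma>2" using 1(3) 2(1) by (rule mset_subset_eqD[rotated])
    have 3: "is_formula S F \<and> (derivable S C (add_mset F \<Gamma>2 \<turnstile> \<Delta>) \<longrightarrow> derivable S C (\<Gamma>2 \<turnstile> \<Delta>))" for \<Delta>
      using saturation_step[OF C 2(2) ab 2(3)] e by simp
    have "\<Gamma> \<subseteq># add_mset F \<Gamma>2"
      using 1(1) 2(1) by (metis add_mset_add_single mset_subset_eq_add_left subset_mset.order_trans)
    then show ?thesis
      using 1(4) 2(2,4) 3 by (intro exI[of _ "add_mset F \<Gamma>2"]) auto
  qed
  show ?thesis
    using assms(1,3,4)
  proof (induction arbitrary: \<Gamma> rule: saturation.induct)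
    case (base e)
    then show ?case
      by (intro exI[of _ \<Gamma>]) (auto simp: contains_equations_def)
  next
    case (left a b e a')
    have "atom_reduces {orient prec e} (Eq a b) (Eq a' b)"
      using left.hyps(4) by (rule atom_reduces.intros)
    from extend[OF left.IH(1)[unfolded fst_conv snd_conv] left.IH(2) left.prems left.hyps(3) this]
    show ?case by simp
  next
    case (right a b e b')
    have "atom_reduces {orient prec e} (Eq a b) (Eq a b')"
      using right.hyps(4) by (rule atom_reduces.intros)
    from extend[OF right.IH(1)[unfolded fst_conv snd_conv] right.IH(2) right.prems right.hyps(3) this]
    show ?case by simp
  qed
qed

lemma saturated_rule_available:
  assumes "atom_reduces (orient prec ` saturation prec E) F F'" and C: "R12_rlplus_prec prec \<subseteq> C"
    and \<Gamma>: "formulas S \<Gamma>" "contains_equations E \<Gamma>"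
  obtains s r e \<Gamma>' where "atom_reduces {(s, r)} F F'" "\<Gamma> \<subseteq># \<Gamma>'" "formulas S \<Gamma>'" "e \<in># \<Gamma>'" "equality e"
    "is_term S r"
    "shortening prec r s \<and> e = Eq r s \<or> nonlengthening prec r s \<and> e = Eq s r"
    "\<And>\<Delta>. derivable S C (\<Gamma>' \<turnstile> \<Delta>) \<Longrightarrow> derivable S C (\<Gamma> \<turnstile> \<Delta>)"
proof -
  obtain d where d: "d \<in> saturation prec E" "atom_reduces {orient prec d} F F'"
    using atom_reduces_single[OF assms(1)] by blast
  obtain a b where ab: "d = (a, b)" by fastforce
  obtain s r where sr: "orient prec (a, b) = (s, r)" by fastforce
  obtain \<Gamma>' where \<Gamma>': "\<Gamma> \<subseteq># \<Gamma>'" "formulas S \<Gamma>'" "Eq a b \<in># \<Gamma>'"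
    "\<And>\<Delta>. derivable S C (\<Gamma>' \<turnstile> \<Delta>) \<Longrightarrow> derivable S C (\<Gamma> \<turnstile> \<Delta>)"
    using saturation_available[OF d(1) C \<Gamma>] ab by auto
  have "is_formula S (Eq a b)" using \<Gamma>' by (auto simp: formulas_def)
  then have "is_term S r"
    using sr by (auto simp: orient_def is_formula_def is_term_def split: if_splits)
  show thesis
  proof (rule that)
    show "atom_reduces {(s, r)} F F'" using d(2) ab sr by simp
    show "shortening prec r s \<and> Eq a b = Eq r s \<or> nonlengthening prec r s \<and> Eq a b = Eq s r"
      using sr by (rule orient_rule)
    show "derivable S C (\<Gamma>' \<turnstile> \<Delta>) \<Longrightarrow> derivable S C (\<Gamma> \<turnstile> \<Delta>)" for \<Delta>
      by (rule \<Gamma>'(4))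
  qed (use \<Gamma>' \<open>is_term S r\<close> in \<open>simp_all add: equality_def\<close>)
qed

text \<open>Each step of a reduction sequence on the right may need equalities that have to be added to the
antecedent first; the antecedent therefore grows along the sequence, and the reduced sequent has to be
derivable over every larger antecedent.\<close>

lemma right_rewriting:
  assumes "(atom_reduces (orient prec ` saturation prec E))\<^sup>*\<^sup>* F F'" and C: "R12_rlplus_prec prec \<subseteq> C"
    and "formulas S \<Gamma>" "contains_equations E \<Gamma>" "is_formula S F" "formulas S \<Delta>"
    and "\<And>\<Gamma>'. \<Gamma> \<subseteq># \<Gamma>' \<Longrightarrow> is_sequent S (\<Gamma>' \<turnstile> add_mset F' \<Delta>) \<Longrightarrow> derivable S C (\<Gamma>' \<turnstile> add_mset F' \<Delta>)"
  shows "derivable S C (\<Gamma> \<turnstile> add_mset F \<Delta>)"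
  using assms(1,3-)
proof (induction arbitrary: \<Gamma> rule: converse_rtranclp_induct)
  case base
  then show ?case by (simp add: is_sequent_formulas)
next
  case (step F F1)
  obtain s r e \<Gamma>' where red: "atom_reduces {(s, r)} F F1" and \<Gamma>': "\<Gamma> \<subseteq># \<Gamma>'" "formulas S \<Gamma>'" "e \<in># \<Gamma>'" "equality e"
    and r: "is_term S r" "shortening prec r s \<and> e = Eq r s \<or> nonlengthening prec r s \<and> e = Eq s r"
    and pull: "\<And>\<Delta>. derivable S C (\<Gamma>' \<turnstile> \<Delta>) \<Longrightarrow> derivable S C (\<Gamma> \<turnstile> \<Delta>)"
    by (rule saturated_rule_available[OF step.hyps(1) C step.prems(1,2)]) blast
  have "derivable S C (\<Gamma>' \<turnstile> add_mset F1 \<Delta>)"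
  proof (rule step.IH)
    show "contains_equations E \<Gamma>'" using step.prems(2) \<Gamma>'(1) by (rule contains_equations_mono)
    show "is_formula S F1" using red r(1) step.prems(3) by (rule atom_reduces_wf)
    show "derivable S C (\<Gamma>'' \<turnstile> add_mset F' \<Delta>)"
      if "\<Gamma>' \<subseteq># \<Gamma>''" "is_sequent S (\<Gamma>'' \<turnstile> add_mset F' \<Delta>)" for \<Gamma>''
      using step.prems(5) that \<Gamma>'(1) subset_mset.order_trans by blast
  qed (use \<Gamma>'(2) step.prems(4) in simp_all)
  then have "derivable S C (\<Gamma>' \<turnstile> add_mset F \<Delta>)"
    using C r(2) \<Gamma>' step.prems(3,4)
    by (intro replace_right[OF _ red, of "shortening prec" C \<Gamma>' "nonlengthening prec"])
      (auto simp: R12_rlplus_prec_def is_sequent_formulas)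
  then show ?case by (rule pull)
qed

text \<open>On the left an atom that is not an equality is rewritten in place, so that what survives is only the
presence of the equations.\<close>

lemma left_rewriting:
  assumes "(atom_reduces (orient prec ` saturation prec E))\<^sup>*\<^sup>* F F'" and C: "R12_rlplus_prec prec \<subseteq> C"
    and "\<not> equality F" "formulas S \<Gamma>" "contains_equations E \<Gamma>" "is_formula S F" "formulas S \<Delta>"
    and "\<And>\<Gamma>'. contains_equations E \<Gamma>' \<Longrightarrow> is_sequent S (add_mset F' \<Gamma>' \<turnstile> \<Delta>)
      \<Longrightarrow> derivable S C (add_mset F' \<Gamma>' \<turnstile> \<Delta>)"
  shows "derivable S C (add_mset F \<Gamma> \<turnstile> \<Delta>)"
  using assms(1,3-)
proof (induction arbitrary: \<Gamma> rule: converse_rtranclp_induct)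
  case base
  then show ?case by (simp add: is_sequent_formulas)
next
  case (step F F1)
  have F\<Gamma>: "formulas S (add_mset F \<Gamma>)" "contains_equations E (add_mset F \<Gamma>)"
    using step.prems by (auto simp: contains_equations_def)
  obtain s r e \<Gamma>' where red: "atom_reduces {(s, r)} F F1"
    and \<Gamma>': "add_mset F \<Gamma> \<subseteq># \<Gamma>'" "formulas S \<Gamma>'" "e \<in># \<Gamma>'" "equality e"
    and r: "is_term S r" "shortening prec r s \<and> e = Eq r s \<or> nonlengthening prec r s \<and> e = Eq s r"
    and pull: "\<And>\<Delta>. derivable S C (\<Gamma>' \<turnstile> \<Delta>) \<Longrightarrow> derivable S C (add_mset F \<Gamma> \<turnstile> \<Delta>)"
    by (rule saturated_rule_available[OF step.hyps(1) C F\<Gamma>]) blast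
  have "F \<in># \<Gamma>'" using \<Gamma>'(1) by (rule mset_subset_eqD) simp
  then obtain \<Gamma>1 where \<Gamma>1: "\<Gamma>' = add_mset F \<Gamma>1" by (metis mset_add)
  \<comment> \<open>\<open>e\<close> is an equality and \<open>F\<close> is not, so they are different occurrences.\<close>
  then have "e \<in># \<Gamma>1" using \<Gamma>'(3,4) step.prems(1) by auto
  then obtain \<Gamma>2 where \<Gamma>2: "\<Gamma>1 = add_mset e \<Gamma>2" by (metis mset_add)
  have "\<Gamma> \<subseteq># \<Gamma>1" using \<Gamma>'(1) \<Gamma>1 by simp
  have notF1: "\<not> equality F1"
    using red step.prems(1) by cases (auto simp: equality_def)
  have "derivable S C (add_mset F1 \<Gamma>1 \<turnstile> \<Delta>)"
  proof (rule step.IH)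
    show "contains_equations E \<Gamma>1" using step.prems(3) \<open>\<Gamma> \<subseteq># \<Gamma>1\<close> by (rule contains_equations_mono)
    show "is_formula S F1" using red r(1) step.prems(4) by (rule atom_reduces_wf)
    show "formulas S \<Gamma>1" using \<Gamma>'(2) \<Gamma>1 by simp
  qed (use notF1 step.prems(5,6) in blast)+
  then have "derivable S C (add_mset e (add_mset F \<Gamma>2) \<turnstile> \<Delta>)"
    using C r(2) \<Gamma>'(2) \<Gamma>1 \<Gamma>2 step.prems(1,5)
    by (intro replace_left[OF _ red, of "shortening prec" C e "nonlengthening prec"])
      (auto simp: R12_rlplus_prec_def is_sequent_formulas add_mset_commute)
  then show ?case using \<Gamma>1 \<Gamma>2 by (intro pull) (simp add: add_mset_commute)
qed

lemma atom_reduces_Eq: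
  assumes "(reduces R)\<^sup>*\<^sup>* t v" "(reduces R)\<^sup>*\<^sup>* u v"
  shows "(atom_reduces R)\<^sup>*\<^sup>* (Eq t u) (Eq v v)"
proof -
  have "(atom_reduces R)\<^sup>*\<^sup>* (Eq t u) (Eq v u)"
    using assms(1) by induction (auto intro: atom_reduces.intros rtranclp.rtrancl_into_rtrancl)
  also have "(atom_reduces R)\<^sup>*\<^sup>* (Eq w u) (Eq w v)" for w
    using assms(2) by induction (auto intro: atom_reduces.intros rtranclp.rtrancl_into_rtrancl)
  finally show ?thesis .
qed

lemma atom_reduces_Pred:
  assumes "list_all2 (reduces R)\<^sup>*\<^sup>* ts us"
  shows "(atom_reduces R)\<^sup>*\<^sup>* (Pred p ts) (Pred p us)"
  using list_steps[OF assms]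
  by induction (auto intro: atom_reduces.intros rtranclp.rtrancl_into_rtrancl)

lemma contains_own_equations [simp]: "contains_equations (equations (set_mset \<Gamma>)) \<Gamma>"
  by (auto simp: contains_equations_def equations_def)

text \<open>Common reducts for the components of two lists, chosen simultaneously.\<close>

lemma list_join:
  assumes "list_all2 (\<lambda>t u. \<exists>v. Q t v \<and> Q u v) ts us"
  shows "\<exists>vs. list_all2 Q ts vs \<and> list_all2 Q us vs"
  using assms
proof (induction rule: list_all2_induct)
  case (Cons t ts u us)
  then obtain v vs where "Q t v" "Q u v" "list_all2 Q ts vs" "list_all2 Q us vs" by blast
  then show ?case by (intro exI[of _ "v # vs"]) simp
qed simp

lemma axiomatic_cases:
  assumes "axiomatic l (signed (\<Gamma> \<turnstile> \<Delta>))" "is_sequent S (\<Gamma> \<turnstile> \<Delta>)" "initial l \<subseteq> C"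
  obtains "derivable S C (\<Gamma> \<turnstile> \<Delta>)"
  | t u \<Delta>' where "\<Delta> = add_mset (Eq t u) \<Delta>'" "eqv (equations (set_mset \<Gamma>)) t u"
  | p ts us \<Gamma>' \<Delta>' where "\<Gamma> = add_mset (Pred p ts) \<Gamma>'" "\<Delta> = add_mset (Pred p us) \<Delta>'"
    "list_all2 (eqv (equations (set_mset \<Gamma>'))) ts us"
proof -
  from assms(1) consider "l \<noteq> Minimal" "Falsum \<in># \<Gamma>" | A where "A \<in># \<Delta>" "entails (set_mset \<Gamma>) A"
    unfolding axiomatic_signed by blast
  then show thesis
  proof cases
    case 1
    then obtain \<Gamma>' where "\<Gamma> = add_mset Falsum \<Gamma>'" by (metis mset_add)
    then have "([], \<Gamma> \<turnstile> \<Delta>) \<in> L_bot" by (auto simp: L_bot_def)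
    moreover have "L_bot \<in> C" using 1 assms(3) by (cases l) auto
    ultimately show thesis using that(1) derivable_initial assms(2) by blast
  next
    case (2 A)
    obtain \<Delta>' where \<Delta>': "\<Delta> = add_mset A \<Delta>'" using 2 by (metis mset_add)
    show thesis
    proof (cases A)
      case Falsum
      then have "Falsum \<in># \<Gamma>" using 2 by simp
      then obtain \<Gamma>' where "\<Gamma> = add_mset Falsum \<Gamma>'" by (metis mset_add)
      then have "([], \<Gamma> \<turnstile> \<Delta>) \<in> L_bot" "([], \<Gamma> \<turnstile> \<Delta>) \<in> Init_bot"
        using \<Delta>' Falsum by (auto simp: L_bot_def Init_bot_def)
      moreover have "L_bot \<in> C \<or> Init_bot \<in> C" using assms(3) by (cases l) auto
      ultimately show thesis using that(1) derivable_initial assms(2) by blast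
    next
      case (Eq t u)
      then show thesis using that(2) 2 \<Delta>' by simp
    next
      case (Pred p us)
      then obtain ts where ts: "Pred p ts \<in># \<Gamma>" "list_all2 (eqv (equations (set_mset \<Gamma>))) ts us"
        using 2 by auto
      then obtain \<Gamma>' where \<Gamma>': "\<Gamma> = add_mset (Pred p ts) \<Gamma>'" by (metis mset_add)
      then have "equations (set_mset \<Gamma>) = equations (set_mset \<Gamma>')" by (auto simp: equations_def)
      then show thesis using that(3)[OF \<Gamma>' \<Delta>'[unfolded Pred]] ts by simp
    qed (use 2 in simp_all)
  qed
qed

lemma equality_axiom: "Ref \<in> C \<Longrightarrow> is_sequent S (\<Gamma> \<turnstile> add_mset (Eq t t) \<Delta>) \<Longrightarrow>
    derivable S C (\<Gamma> \<turnstile> add_mset (Eq t t) \<Delta>)"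
  by (rule derivable_initial[of Ref]) (auto simp: Ref_def)

lemma initial_sequent:
  assumes "initial l \<subseteq> C" "atomic P" "P \<in># \<Gamma>" "is_sequent S (\<Gamma> \<turnstile> add_mset P \<Delta>)"
  shows "derivable S C (\<Gamma> \<turnstile> add_mset P \<Delta>)"
proof (rule derivable_initial[of Init])
  show "Init \<in> C" using assms(1) by (cases l) auto
  obtain \<Gamma>' where "\<Gamma> = add_mset P \<Gamma>'" using assms(3) by (metis mset_add)
  then show "([], \<Gamma> \<turnstile> add_mset P \<Delta>) \<in> Init" using assms(2) by (auto simp: Init_def)
qed (fact assms(4))

text \<open>Congruent terms have a common reduct. An equality in the succedent is reduced to an instance of
reflexivity; other atoms are reduced on both sides until they coincide.\<close>

theorem restricted_complete:
  assumes ax: "axiomatic l (signed (\<Gamma> \<turnstile> \<Delta>))" and wf: "is_sequent S (\<Gamma> \<turnstile> \<Delta>)"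
    and C: "initial l \<subseteq> C" "R12_rlplus_prec prec \<subseteq> C"
  shows "derivable S C (\<Gamma> \<turnstile> \<Delta>)"
  using ax wf C(1)
proof (cases rule: axiomatic_cases)
  case (2 t u \<Delta>')
  let ?R = "orient prec ` saturation prec (equations (set_mset \<Gamma>))"
  obtain v where "(reduces ?R)\<^sup>*\<^sup>* t v" "(reduces ?R)\<^sup>*\<^sup>* u v"
    using saturated_join[OF 2(2)] by blast
  then have "(atom_reduces ?R)\<^sup>*\<^sup>* (Eq t u) (Eq v v)" by (rule atom_reduces_Eq)
  then show ?thesis
    unfolding 2(1)
  proof (rule right_rewriting[OF _ C(2)])
    show "derivable S C (\<Gamma>' \<turnstile> add_mset (Eq v v) \<Delta>')" if "is_sequent S (\<Gamma>' \<turnstile> add_mset (Eq v v) \<Delta>')" for \<Gamma>'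
      using that C(2) by (intro equality_axiom) (auto simp: R12_rlplus_prec_def)
  qed (use wf 2(1) in \<open>simp_all add: is_sequent_formulas\<close>)
next
  case (3 p ts us \<Gamma>' \<Delta>')
  let ?E = "equations (set_mset \<Gamma>')"
  let ?R = "orient prec ` saturation prec ?E"
  have "list_all2 (\<lambda>t u. \<exists>v. (reduces ?R)\<^sup>*\<^sup>* t v \<and> (reduces ?R)\<^sup>*\<^sup>* u v) ts us"
    using 3(3) by (rule list_all2_mono) (rule saturated_join)
  then obtain vs where "list_all2 (reduces ?R)\<^sup>*\<^sup>* ts vs" "list_all2 (reduces ?R)\<^sup>*\<^sup>* us vs"
    using list_join[of "(reduces ?R)\<^sup>*\<^sup>*" ts us] by blast
  then have ts: "(atom_reduces ?R)\<^sup>*\<^sup>* (Pred p ts) (Pred p vs)"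
    and us: "(atom_reduces ?R)\<^sup>*\<^sup>* (Pred p us) (Pred p vs)"
    by (auto intro: atom_reduces_Pred)
  from ts show ?thesis
    unfolding 3(1,2)
  proof (rule left_rewriting[OF _ C(2)])
    fix \<Gamma>2 :: "('a, 'b) fm multiset"
    assume \<Gamma>2: "contains_equations ?E \<Gamma>2" "is_sequent S (add_mset (Pred p vs) \<Gamma>2 \<turnstile> add_mset (Pred p us) \<Delta>')"
    from us show "derivable S C (add_mset (Pred p vs) \<Gamma>2 \<turnstile> add_mset (Pred p us) \<Delta>')"
    proof (rule right_rewriting[OF _ C(2)])
      fix \<Gamma>3 :: "('a, 'b) fm multiset"
      assume "add_mset (Pred p vs) \<Gamma>2 \<subseteq># \<Gamma>3" "is_sequent S (\<Gamma>3 \<turnstile> add_mset (Pred p vs) \<Delta>')"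
      then show "derivable S C (\<Gamma>3 \<turnstile> add_mset (Pred p vs) \<Delta>')"
        by (intro initial_sequent[OF C(1)]) (auto simp: atomic_def insert_subset_eq_iff)
    qed (use \<Gamma>2 in \<open>auto simp: is_sequent_formulas contains_equations_def\<close>)
  qed (use wf 3(1,2) in \<open>auto simp: is_sequent_formulas equality_def\<close>)
qed

text \<open>When both directions of every equality are allowed, rewriting is symmetric, and one can go all the way
from one side of an equality to the other, or from the atom in the succedent to the one in the
antecedent, without touching the antecedent.\<close>

theorem unrestricted_complete:
  assumes ax: "axiomatic l (signed (\<Gamma> \<turnstile> \<Delta>))" and wf: "is_sequent S (\<Gamma> \<turnstile> \<Delta>)"
    and C: "initial l \<subseteq> C" "R12_r \<subseteq> C"
  shows "derivable S C (\<Gamma> \<turnstile> \<Delta>)"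
proof -
  define E where "E = equations (set_mset \<Gamma>)"
  define R where "R = E \<union> E\<inverse>"
  have sym: "reduces R t u" if "reduces R u t" for t u
    using that
  proof (induction rule: reduces.induct)
    case (arg i ts u f)
    then have "reduces R (Fn f (ts[i := u])) (Fn f (ts[i := u, i := ts ! i]))"
      by (intro reduces.arg) auto
    then show ?case by simp
  qed (auto simp: R_def intro: reduces.root)
  have red: "(reduces R)\<^sup>*\<^sup>* t u" if "eqv E t u" for t u
  proof -
    have "equivclp (reduces R) t u"
      using that by (rule eqv_equivclp) (auto simp: R_def)
    moreover have "symclp (reduces R) = reduces R"
      using sym by (intro symp_symclp_eq sympI)
    ultimately show ?thesis by (simp add: equivclp_def)
  qed
  have replace: "derivable S C (\<Gamma> \<turnstile> add_mset F \<Delta>')"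
    if "(atom_reduces R)\<^sup>*\<^sup>* F F'" "is_sequent S (\<Gamma> \<turnstile> add_mset F \<Delta>')"
      and "is_sequent S (\<Gamma> \<turnstile> add_mset F' \<Delta>') \<Longrightarrow> derivable S C (\<Gamma> \<turnstile> add_mset F' \<Delta>')" for F F' \<Delta>'
    using that
  proof (induction rule: converse_rtranclp_induct)
    case (step F F1)
    obtain s r where sr: "(s, r) \<in> R" "atom_reduces {(s, r)} F F1"
      using atom_reduces_single[OF step.hyps(1)] by auto
    then have eq: "Eq r s \<in># \<Gamma> \<or> Eq s r \<in># \<Gamma>" by (auto simp: R_def E_def equations_def)
    then have "is_term S r"
      using step.prems(1) by (force simp: is_sequent_iff is_term_def is_formula_def)
    then have "is_sequent S (\<Gamma> \<turnstile> add_mset F1 \<Delta>')"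
      using atom_reduces_wf[OF sr(2)] step.prems(1) by (simp add: is_sequent_formulas)
    then have "derivable S C (\<Gamma> \<turnstile> add_mset F1 \<Delta>')" using step.IH step.prems(2) by blast
    then show ?case
      using C(2) eq step.prems(1)
      by (intro replace_right[OF _ sr(2), of "\<lambda>_ _. True" C \<Gamma> "\<lambda>_ _. True"]) (auto simp: R12_r_def)
  qed simp
  from ax wf C(1) show ?thesis
  proof (cases rule: axiomatic_cases)
    case (2 t u \<Delta>')
    have "(atom_reduces R)\<^sup>*\<^sup>* (Eq t u) (Eq u u)"
      using 2(2) red by (intro atom_reduces_Eq) (auto simp: E_def)
    then show ?thesis
      using wf unfolding 2(1)
    proof (rule replace)
      show "derivable S C (\<Gamma> \<turnstile> add_mset (Eq u u) \<Delta>')" if "is_sequent S (\<Gamma> \<turnstile> add_mset (Eq u u) \<Delta>')"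
        using that C(2) by (intro equality_axiom) (auto simp: R12_r_def)
    qed
  next
    case (3 p ts us \<Gamma>' \<Delta>')
    have "E = equations (set_mset \<Gamma>')" using 3(1) by (auto simp: E_def equations_def)
    then have "list_all2 (eqv E) us ts"
      using 3(3) by (auto simp: list_all2_conv_all_nth intro: eqv.sym)
    then have "list_all2 (reduces R)\<^sup>*\<^sup>* us ts" by (rule list_all2_mono) (rule red)
    then have "(atom_reduces R)\<^sup>*\<^sup>* (Pred p us) (Pred p ts)" by (rule atom_reduces_Pred)
    then show ?thesis
      using wf unfolding 3(2)
    proof (rule replace)
      show "derivable S C (\<Gamma> \<turnstile> add_mset (Pred p ts) \<Delta>')" if "is_sequent S (\<Gamma> \<turnstile> add_mset (Pred p ts) \<Delta>')"
        using that 3(1) by (intro initial_sequent[OF C(1)]) (auto simp: atomic_def)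
    qed
  qed
qed

section \<open>A logical calculus whose leaves are the axiomatic sequents\<close>

text \<open>The logical rules as a principal formula with the set of formulas added in each premiss. Right
\<open>\<forall>\<close> and left \<open>\<exists>\<close> have one premiss for each term instead of an eigenvariable; this removes renaming
from all structural arguments, and makes the instance \<open>A[t]\<close> that is needed in a cut on a quantified
formula one of the premisses.\<close>

inductive logical ::
  "('f, 'p) signature \<Rightarrow> logic \<Rightarrow> ('f, 'p) signed_fm \<Rightarrow> ('f, 'p) signed_fm multiset set \<Rightarrow> bool" for S l where
  LConj: "logical S l (Lft (Conj A B)) {{#Lft A, Lft B#}}"
| RConj: "logical S l (Rgt (Conj A B)) {{#Rgt A#}, {#Rgt B#}}"
| LDisj: "logical S l (Lft (Disj A B)) {{#Lft A#}, {#Lft B#}}"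
| RDisj: "logical S l (Rgt (Disj A B)) {{#Rgt A, Rgt B#}}"
| LImp: "logical S l (Lft (Imp A B))
    {if l = Classical then {#Rgt A#} else {#Lft (Imp A B), Rgt A#}, {#Lft B#}}"
| RImp: "logical S l (Rgt (Imp A B)) {{#Lft A, Rgt B#}}"
| LAll: "is_term S t \<Longrightarrow>
    logical S l (Lft (All x A)) {{#Lft (All x A), Lft (subst_fm (Bound x) t A)#}}"
| RAll: "logical S l (Rgt (All x A)) ((\<lambda>t. {#Rgt (subst_fm (Bound x) t A)#}) ` {t. is_term S t})"
| LEx: "logical S l (Lft (Ex x A)) ((\<lambda>t. {#Lft (subst_fm (Bound x) t A)#}) ` {t. is_term S t})"
| REx: "is_term S t \<Longrightarrow>
    logical S l (Rgt (Ex x A)) {{#Rgt (Ex x A), Rgt (subst_fm (Bound x) t A)#}}"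

inductive_simps logical_iffs:
  "logical S l (Lft (Conj A B)) Ps" "logical S l (Rgt (Conj A B)) Ps"
  "logical S l (Lft (Disj A B)) Ps" "logical S l (Rgt (Disj A B)) Ps"
  "logical S l (Lft (Imp A B)) Ps" "logical S l (Rgt (Imp A B)) Ps"
  "logical S l (Lft (All x A)) Ps" "logical S l (Rgt (All x A)) Ps"
  "logical S l (Lft (Ex x A)) Ps" "logical S l (Rgt (Ex x A)) Ps"

text \<open>In minimal and intuitionistic logic the right rules for implication and universal quantification
discard the other formulas of the succedent.\<close>

fun drops_succedents :: "logic \<Rightarrow> ('f, 'p) signed_fm \<Rightarrow> bool" where
  "drops_succedents l (Rgt (Imp A B)) = (l \<noteq> Classical)"
| "drops_succedents l (Rgt (All x A)) = (l \<noteq> Classical)"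
| "drops_succedents l _ = False"

fun is_left :: "('f, 'p) signed_fm \<Rightarrow> bool" where
  "is_left (Lft A) = True"
| "is_left (Rgt A) = False"

definition kept_context :: "logic \<Rightarrow> ('f, 'p) signed_fm \<Rightarrow> ('f, 'p) signed_fm multiset \<Rightarrow> ('f, 'p) signed_fm multiset" where
  "kept_context l F M = (if drops_succedents l F then filter_mset is_left M else M)"

inductive prov :: "('f, 'p) signature \<Rightarrow> logic \<Rightarrow> ('f, 'p) signed_fm multiset \<Rightarrow> bool" for S l where
  axiom: "axiomatic l M \<Longrightarrow> prov S l M"
| step: "logical S l F Ps \<Longrightarrow> (\<And>P. P \<in> Ps \<Longrightarrow> prov S l (P + kept_context l F M)) \<Longrightarrow> prov S l (add_mset F M)"

lemma kept_context_plus [simp]: "kept_context l F (M + N) = kept_context l F M + kept_context l F N"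
  by (simp add: kept_context_def)

lemma kept_context_all [simp]: "\<not> drops_succedents l F \<Longrightarrow> kept_context l F M = M"
  by (simp add: kept_context_def)

lemma drops_succedents_right: "drops_succedents l F \<Longrightarrow> \<not> is_left F \<and> l \<noteq> Classical"
  by (cases "(l, F)" rule: drops_succedents.cases) auto

lemma kept_context_left [simp]: "drops_succedents l F \<Longrightarrow> kept_context l F M = filter_mset is_left M"
  by (simp add: kept_context_def)

lemma logical_not_prime: "logical S l F Ps \<Longrightarrow> \<not> signed_prime F"
  by (auto elim: logical.cases)

lemma prov_weaken: "prov S l M \<Longrightarrow> prov S l (M + N)"
proof (induction arbitrary: N rule: prov.induct)
  case (axiom M)
  then show ?case by (intro prov.axiom) (erule axiomatic_mono, simp)
next
  case (step F Ps M)
  have "prov S l (add_mset F (M + N))"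
  proof (rule prov.step[OF step.hyps(1)])
    fix P
    assume "P \<in> Ps"
    then show "prov S l (P + kept_context l F (M + N))"
      using step.IH[of P "kept_context l F N"] by (simp add: add.assoc)
  qed
  then show ?case by simp
qed

lemma prov_weaken_le: "prov S l M \<Longrightarrow> M \<subseteq># N \<Longrightarrow> prov S l N"
  using prov_weaken[of S l M "N - M"] by simp

text \<open>The side condition \<open>F \<notin># P\<close> excludes the rules that repeat their principal formula. For the others
the principal formula determines the premisses.\<close>

lemma logical_unique:
  assumes "logical S l F Ps" "P \<in> Ps" "F \<notin># P" "logical S l F Qs"
  shows "Qs = Ps"
  using assms by (cases rule: logical.cases) (auto simp: logical_iffs)

text \<open>Why inversion survives a rule that discards succedents: the formulas that inversion puts in the place
of a retained left formula are themselves on the left, and so are retained too.\<close>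

lemma invertible_premise_left:
  assumes "logical S l F Ps" "P \<in> Ps" "F \<notin># P" "is_left F" "l \<noteq> Classical"
  shows "filter_mset is_left P = P"
  using assms by (cases rule: logical.cases) auto

lemma add_eq_add_cases:
  assumes "add_mset F M = add_mset G N"
  obtains "F = G" "M = N" | N' where "F \<noteq> G" "N = add_mset F N'" "M = add_mset G N'"
  using assms unfolding add_eq_conv_ex by blast

text \<open>Either the premiss repeats the principal formula, and weakening suffices, or \<open>F\<close> can be replaced by
\<open>P\<close> throughout the derivation, since axiomatic leaves do not depend on the compound formula \<open>F\<close>.\<close>

lemma prov_invert:
  assumes F: "logical S l F Ps" "P \<in> Ps" "\<not> drops_succedents l F"
    and "prov S l (add_mset F M)"
  shows "prov S l (P + M)"
proof (cases "F \<in># P")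
  case True
  then obtain P' where "P = add_mset F P'" by (metis mset_add)
  then show ?thesis using prov_weaken[OF assms(4), of P'] by (simp add: ac_simps)
next
  case False
  show ?thesis
    using assms(4)
  proof (induction "add_mset F M" arbitrary: M rule: prov.induct)
    case axiom
    have "axiomatic l (P + M)"
      using axiom by (rule axiomatic_mono) (use logical_not_prime[OF F(1)] in auto)
    then show ?case by (rule prov.axiom)
  next
    case (step G Qs N)
    from step.hyps(4)[symmetric] show ?case
    proof (cases rule: add_eq_add_cases)
      case 1
      then have "Qs = Ps" using logical_unique[OF F(1,2) False] step.hyps(1) by simp
      then show ?thesis using step.hyps(2)[of P] 1 F by simp
    next
      case (2 N')
      have "prov S l (add_mset G (P + N'))"
      proof (rule prov.step[OF step.hyps(1)])
        fix Q
        assume Q: "Q \<in> Qs"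
        show "prov S l (Q + kept_context l G (P + N'))"
        proof (cases "drops_succedents l G \<and> \<not> is_left F")
          case True
          then have "prov S l (Q + kept_context l G N')"
            using step.hyps(2)[OF Q] 2 by simp
          then show ?thesis by (rule prov_weaken_le) simp
        next
          case keep: False
          then have "prov S l (P + (Q + kept_context l G N'))"
            using step.hyps(3)[OF Q, of "Q + kept_context l G N'"] 2
            by (cases "drops_succedents l G") auto
          moreover have "kept_context l G P = P"
            using keep invertible_premise_left[OF F(1,2) False] drops_succedents_right[of l G]
            by (cases "drops_succedents l G") auto
          ultimately show ?thesis by (simp add: ac_simps)
        qed
      qed
      then show ?thesis using 2 by simp
    qed
  qed
qed

section \<open>Contraction\<close>

fun fm_size :: "('f, 'p) fm \<Rightarrow> nat" where
  "fm_size (Conj A B) = Suc (fm_size A + fm_size B)"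
| "fm_size (Disj A B) = Suc (fm_size A + fm_size B)"
| "fm_size (Imp A B) = Suc (fm_size A + fm_size B)"
| "fm_size (All x A) = Suc (fm_size A)"
| "fm_size (Ex x A) = Suc (fm_size A)"
| "fm_size _ = 0"

fun signed_size :: "('f, 'p) signed_fm \<Rightarrow> nat" where
  "signed_size (Lft A) = fm_size A"
| "signed_size (Rgt A) = fm_size A"

lemma fm_size_subst [simp]: "fm_size (subst_fm x t A) = fm_size A"
  by (induction A) auto

lemma logical_size:
  "logical S l F Ps \<Longrightarrow> P \<in> Ps \<Longrightarrow> G \<in># P \<Longrightarrow> G = F \<or> signed_size G < signed_size F"
  by (auto elim!: logical.cases split: if_splits)

lemma contract_multiset:
  assumes "\<And>F N. F \<in># M \<Longrightarrow> prov S l (add_mset F (add_mset F N)) \<Longrightarrow> prov S l (add_mset F N)"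
    and "prov S l (M + M + N)"
  shows "prov S l (M + N)"
  using assms
proof (induction M arbitrary: N)
  case (add F M)
  have "prov S l (add_mset F (add_mset F (M + M + N)))"
    using add.prems(2) by (simp add: ac_simps)
  then have "prov S l (add_mset F (M + M + N))"
    by (rule add.prems(1)[rotated]) simp
  then have "prov S l (M + M + add_mset F N)"
    by simp
  with _ have "prov S l (M + add_mset F N)"
    by (rule add.IH) (rule add.prems(1), simp_all)
  then show ?case by simp
qed simp

text \<open>Outer induction on the size of the contracted formula, inner induction on the derivation. If one copy
is principal in a rule without repetition, inversion of the other copy leaves only smaller formulas to
contract; the outer induction hypothesis covers these, however long the inverted derivation is.\<close>

lemma prov_contract:
  "prov S l (add_mset F (add_mset F M)) \<Longrightarrow> prov S l (add_mset F M)"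
proof (induction "signed_size F" arbitrary: F M rule: less_induct)
  case less
  show ?case
    using less.prems
  proof (induction "add_mset F (add_mset F M)" arbitrary: M rule: prov.induct)
    case axiom
    then show ?case by (intro prov.axiom) (erule axiomatic_mono, auto)
  next
    case (step G Qs N)
    from step.hyps(4)[symmetric] show ?case
    proof (cases rule: add_eq_add_cases)
      case 1
      have "prov S l (add_mset F M)"
      proof (rule prov.step)
        show "logical S l F Qs" using step.hyps(1) 1 by simp
        fix Q
        assume Q: "Q \<in> Qs"
        then have *: "prov S l (Q + kept_context l F (add_mset F M))"
          using step.hyps(2) 1 by auto
        show "prov S l (Q + kept_context l F M)"
        proof (cases "drops_succedents l F")
          case True
          then show ?thesis using * drops_succedents_right[of l F] by simp
        next
          case False
          show ?thesis
          proof (cases "F \<in># Q")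
            case True
            then obtain Q' where "Q = add_mset F Q'" by (metis mset_add)
            then show ?thesis
              using step.hyps(3)[OF Q, of "Q' + M"] 1 False by simp
          next
            case notin: False
            have "prov S l (add_mset F (Q + M))" using * False by simp
            \<comment> \<open>One copy of \<open>F\<close> was decomposed by the rule; the other one is inverted.\<close>
            with _ Q False have "prov S l (Q + (Q + M))"
              by (rule prov_invert) (use step.hyps(1) 1 in simp)
            then have "prov S l (Q + Q + M)" by (simp add: add.assoc)
            with _ have "prov S l (Q + M)"
            proof (rule contract_multiset)
              fix F' N
              assume "F' \<in># Q" "prov S l (add_mset F' (add_mset F' N))"
              moreover from this have "signed_size F' < signed_size F"
                using logical_size[OF step.hyps(1) Q] notin 1(1) by metis
              ultimately show "prov S l (add_mset F' N)"
                using less.hyps by blast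
            qed
            then show ?thesis using False by simp
          qed
        qed
      qed
      then show ?thesis .
    next
      case (2 N')
      then obtain N'' where N'': "N' = add_mset F N''" "M = add_mset G N''"
        by (metis add_eq_conv_ex)
      have "prov S l (add_mset G (add_mset F N''))"
      proof (rule prov.step[OF step.hyps(1)])
        fix Q
        assume Q: "Q \<in> Qs"
        have "prov S l (Q + kept_context l G (add_mset F (add_mset F N'')))"
          using step.hyps(2)[OF Q] 2 N'' by simp
        moreover have "prov S l (add_mset F (Q + kept_context l G N''))"
          if "kept_context l G (add_mset F (add_mset F N'')) = add_mset F (add_mset F (kept_context l G N''))"
          using step.hyps(3)[OF Q, of "Q + kept_context l G N''"] 2 N'' that by simp
        ultimately show "prov S l (Q + kept_context l G (add_mset F N''))"
          by (cases "drops_succedents l G"; cases "is_left F") auto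
      qed
      then show ?thesis using 2 N'' by (simp add: add_mset_commute)
    qed
  qed
qed

text \<open>Weakening and contraction together: provability depends on the set of signed formulas.\<close>

lemma prov_set_mono:
  assumes "prov S l M" "set_mset M \<subseteq> set_mset N"
  shows "prov S l N"
  using assms
proof (induction "size M" arbitrary: M rule: less_induct)
  case less
  show ?case
  proof (cases "M \<subseteq># N")
    case True
    with less.prems(1) show ?thesis by (rule prov_weaken_le)
  next
    case False
    then obtain F where F: "count M F > count N F"
      by (meson leI mset_subset_eqI)
    then have "F \<in># M"
      by (metis count_greater_zero_iff gr_zeroI not_less_zero)
    then obtain M' where M': "M = add_mset F M'" by (metis mset_add)
    have "F \<in># N" using \<open>F \<in># M\<close> less.prems(2) by auto
    then have "F \<in># M'" using F M' by (simp flip: count_greater_zero_iff)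
    then obtain M'' where "M' = add_mset F M''" by (metis mset_add)
    then have "prov S l M'" using prov_contract less.prems(1) M' by blast
    then show ?thesis using less.hyps[of M'] less.prems(2) M' by simp
  qed
qed

section \<open>Cut\<close>

text \<open>A cut is permuted upwards in the derivation of its left premiss until the cut formula is principal or
entailed at a leaf. In a rule that discards succedents the cut formula disappears as well, and the
conclusion follows by weakening.\<close>

lemma cut_reduce_left:
  assumes "prov S l (add_mset (Rgt A) M)"
    and ax: "\<And>M. entails (lefts M) A \<Longrightarrow> prov S l (M + N)"
    and principal: "\<And>Ps M. logical S l (Rgt A) Ps
      \<Longrightarrow> (\<And>P. P \<in> Ps \<Longrightarrow> prov S l (P + kept_context l (Rgt A) M))
      \<Longrightarrow> (\<And>P. add_mset (Rgt A) P \<in> Ps \<Longrightarrow> prov S l (P + kept_context l (Rgt A) M + N))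
      \<Longrightarrow> prov S l (M + N)"
  shows "prov S l (M + N)"
  using assms(1)
proof (induction "add_mset (Rgt A) M" arbitrary: M rule: prov.induct)
  case axiom
  then consider "axiomatic l M" | "entails (lefts M) A"
    using axiomatic_succedent_cases by blast
  then show ?case
    by cases (auto intro: prov_weaken prov.axiom ax)
next
  case (step G Qs K)
  from step.hyps(4)[symmetric] show ?case
  proof (cases rule: add_eq_add_cases)
    case 1
    show ?thesis
    proof (rule principal)
      show "logical S l (Rgt A) Qs" using step.hyps(1) 1 by simp
      show "prov S l (P + kept_context l (Rgt A) M)" if "P \<in> Qs" for P
        using step.hyps(2)[OF that] 1 by simp
      show "prov S l (P + kept_context l (Rgt A) M + N)" if "add_mset (Rgt A) P \<in> Qs" for P
        using step.hyps(3)[OF that, of "P + kept_context l (Rgt A) M"] 1 by simp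
    qed
  next
    case (2 K')
    show ?thesis
    proof (cases "drops_succedents l G")
      case True
      have "prov S l (add_mset G K')"
      proof (rule prov.step[OF step.hyps(1)])
        fix Q
        assume "Q \<in> Qs"
        from step.hyps(2)[OF this] show "prov S l (Q + kept_context l G K')"
          using 2 True by simp
      qed
      then have "prov S l (add_mset G K' + N)" by (rule prov_weaken)
      then show ?thesis using 2 by simp
    next
      case False
      have "prov S l (add_mset G (K' + N))"
      proof (rule prov.step[OF step.hyps(1)])
        fix Q
        assume Q: "Q \<in> Qs"
        have "prov S l (Q + K' + N)"
          by (rule step.hyps(3)[OF Q]) (use 2 False in simp)
        then show "prov S l (Q + kept_context l G (K' + N))"
          using False by (simp add: add.assoc)
      qed
      then show ?thesis using 2 by simp
    qed
  qed
qed

text \<open>On the right the context \<open>M\<close> of the other premiss has to pass through rules that discard succedents;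
outside classical logic it must therefore consist of antecedent formulas.\<close>

lemma cut_reduce_right:
  assumes "prov S l (add_mset (Lft A) N)"
    and kept: "l = Classical \<or> filter_mset is_left M = M"
    and ax: "\<And>N. axiomatic l (add_mset (Lft A) N) \<Longrightarrow> prov S l (M + N)"
    and principal: "\<And>Ps N. logical S l (Lft A) Ps
      \<Longrightarrow> (\<And>P. P \<in> Ps \<Longrightarrow> prov S l (P + N))
      \<Longrightarrow> (\<And>P. add_mset (Lft A) P \<in> Ps \<Longrightarrow> prov S l (M + (P + N)))
      \<Longrightarrow> prov S l (M + N)"
  shows "prov S l (M + N)"
  using assms(1)
proof (induction "add_mset (Lft A) N" arbitrary: N rule: prov.induct)
  case axiom
  then show ?case by (rule ax)
next
  case (step G Qs K)
  from step.hyps(4)[symmetric] show ?case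
  proof (cases rule: add_eq_add_cases)
    case 1
    have nodrop: "\<not> drops_succedents l G" using 1(1) by auto
    show ?thesis
    proof (rule principal)
      show "logical S l (Lft A) Qs" using step.hyps(1) 1 by simp
      show "prov S l (P + N)" if "P \<in> Qs" for P
        using step.hyps(2)[OF that] 1 nodrop by simp
      show "prov S l (M + (P + N))" if "add_mset (Lft A) P \<in> Qs" for P
        by (rule step.hyps(3)[OF that]) (use 1 nodrop in simp)
    qed
  next
    case (2 K')
    have "prov S l (add_mset G (M + K'))"
    proof (rule prov.step[OF step.hyps(1)])
      fix Q
      assume Q: "Q \<in> Qs"
      have "prov S l (M + (Q + kept_context l G K'))"
        by (rule step.hyps(3)[OF Q]) (use 2 in \<open>cases "drops_succedents l G"; simp\<close>)
      moreover have "kept_context l G M = M"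
        using kept drops_succedents_right[of l G] by (cases "drops_succedents l G") auto
      ultimately show "prov S l (Q + kept_context l G (M + K'))"
        by (simp add: ac_simps)
    qed
    then show ?thesis using 2 by simp
  qed
qed

text \<open>At a leaf of the left derivation the cut formula is entailed by the antecedent alone. Discarding the
succedent there makes the context fit for the second permutation, and at the leaves of the right
derivation the cut formula is removed by transitivity of consequence.\<close>

lemma cut_prime:
  assumes "prov S l (add_mset (Rgt A) M)" "prov S l (add_mset (Lft A) N)" "prime A"
  shows "prov S l (M + N)"
  using assms(1)
proof (rule cut_reduce_left)
  fix M
  assume ent: "entails (lefts M) A"
  have "prov S l (filter_mset is_left M + N)"
    using assms(2)
  proof (rule cut_reduce_right)
    show "l = Classical \<or> filter_mset is_left (filter_mset is_left M) = filter_mset is_left M"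
      by (simp add: multiset_eq_iff)
  next
    fix N :: "('a, 'b) signed_fm multiset"
    let ?K = "filter_mset is_left M + N"
    assume "axiomatic l (add_mset (Lft A) N)"
    then have "axiomatic l (add_mset (Lft A) ?K)"
      by (rule axiomatic_mono) auto
    moreover have "entails (lefts ?K) A"
      using ent by (rule entails_mono) (auto simp: lefts_def)
    ultimately show "prov S l ?K"
      by (intro prov.axiom) (rule axiomatic_entailed)
  next
    show "logical S l (Lft A) Ps \<Longrightarrow> prov S l (filter_mset is_left M + N)" for Ps N
      using logical_not_prime[of S l "Lft A"] assms(3) by auto
  qed
  then show "prov S l (M + N)"
    by (rule prov_weaken_le) simp
next
  show "logical S l (Rgt A) Ps \<Longrightarrow> prov S l (M + N)" for Ps M
    using logical_not_prime[of S l "Rgt A"] assms(3) by auto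
qed

text \<open>Induction on the size of the cut formula. Conjunctions, disjunctions and the right premiss for \<open>\<exists>\<close>
are treated by inversion. Right implication and right \<open>\<forall>\<close> are invertible only classically, so
there the left derivation is followed to the point where the cut formula is principal: in the other
logics its context has then lost its succedent, which is what permutation in the right derivation
requires.\<close>

theorem prov_cut:
  "prov S l (add_mset (Rgt A) M) \<Longrightarrow> prov S l (add_mset (Lft A) N) \<Longrightarrow> prov S l (M + N)"
proof (induction "fm_size A" arbitrary: A M N rule: less_induct)
  case less
  note cut = less.hyps
  note left = less.prems(1) and right = less.prems(2)
  show ?case
  proof (cases A)
    case Falsum
    then show ?thesis using left right by (auto intro: cut_prime)
  next
    case (Eq t u)
    then show ?thesis using left right by (auto intro: cut_prime)
  next
    case (Pred p ts)
    then show ?thesis using left right by (auto intro: cut_prime)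
  next
    case (Conj B C)
    have BC: "prov S l ({#Rgt B#} + M)" "prov S l ({#Rgt C#} + M)"
      by (rule prov_invert[OF logical.RConj _ _ left[unfolded Conj]], simp, simp)+
    have B: "prov S l (add_mset (Rgt B) M)" and C: "prov S l (add_mset (Rgt C) M)"
      using BC by simp_all
    have "prov S l ({#Lft B, Lft C#} + N)"
      by (rule prov_invert[OF logical.LConj _ _ right[unfolded Conj]]) auto
    then have "prov S l (add_mset (Lft B) (add_mset (Lft C) N))" by simp
    then have "prov S l (M + add_mset (Lft C) N)" by (rule cut[OF _ B, rotated]) (simp add: Conj)
    then have "prov S l (add_mset (Lft C) (M + N))" by simp
    then have "prov S l (M + (M + N))" by (rule cut[OF _ C, rotated]) (simp add: Conj)
    then show ?thesis by (rule prov_set_mono) auto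
  next
    case (Disj B C)
    have BC: "prov S l ({#Lft B#} + N)" "prov S l ({#Lft C#} + N)"
      by (rule prov_invert[OF logical.LDisj _ _ right[unfolded Disj]], simp, simp)+
    have B: "prov S l (add_mset (Lft B) N)" and C: "prov S l (add_mset (Lft C) N)"
      using BC by simp_all
    have "prov S l ({#Rgt B, Rgt C#} + M)"
      by (rule prov_invert[OF logical.RDisj _ _ left[unfolded Disj]]) auto
    then have "prov S l (add_mset (Rgt B) (add_mset (Rgt C) M))" by simp
    then have "prov S l (add_mset (Rgt C) M + N)" by (rule cut[OF _ _ B, rotated]) (simp add: Disj)
    then have "prov S l (add_mset (Rgt C) (M + N))" by simp
    then have "prov S l (M + N + N)" by (rule cut[OF _ _ C, rotated]) (simp add: Disj)
    then show ?thesis by (rule prov_set_mono) auto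
  next
    case (Imp B C)
    show ?thesis
      using left
    proof (rule cut_reduce_left)
      fix Ps M
      assume "logical S l (Rgt A) Ps" "\<And>P. P \<in> Ps \<Longrightarrow> prov S l (P + kept_context l (Rgt A) M)"
      then have BC: "prov S l (add_mset (Rgt C) (add_mset (Lft B) (kept_context l (Rgt A) M)))"
        by (simp add: Imp logical_iffs add_mset_commute)
      let ?M = "kept_context l (Rgt A) M"
      have "prov S l (?M + N)"
        using right
      proof (rule cut_reduce_right)
        show "l = Classical \<or> filter_mset is_left ?M = ?M" by (simp add: Imp kept_context_def multiset_eq_iff)
      next
        fix N :: "('a, 'b) signed_fm multiset"
        assume "axiomatic l (add_mset (Lft A) N)"
        then have "axiomatic l (?M + N)" by (rule axiomatic_mono) (auto simp: Imp)
        then show "prov S l (?M + N)" by (rule prov.axiom)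
      next
        fix Qs N
        assume Qs: "logical S l (Lft A) Qs" "\<And>P. P \<in> Qs \<Longrightarrow> prov S l (P + N)"
          "\<And>P. add_mset (Lft A) P \<in> Qs \<Longrightarrow> prov S l (?M + (P + N))"
        \<comment> \<open>Outside classical logic the left premiss repeats the cut formula, which the inner induction has removed.\<close>
        have B: "prov S l (add_mset (Rgt B) (?M + N))"
        proof (cases "l = Classical")
          case True
          then have "prov S l (add_mset (Rgt B) N)" using Qs(1) Qs(2)[of "{#Rgt B#}"] by (simp add: Imp logical_iffs)
          then show ?thesis by (rule prov_weaken_le) simp
        next
          case False
          then show ?thesis using Qs(3)[of "{#Rgt B#}"] Qs(1) by (simp add: Imp logical_iffs)
        qed
        have C: "prov S l (add_mset (Lft C) N)" using Qs(1) Qs(2)[of "{#Lft C#}"] by (simp add: Imp logical_iffs)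
        have "prov S l (add_mset (Rgt C) ?M + N)"
        proof -
          have "prov S l (add_mset (Lft B) (add_mset (Rgt C) ?M))"
            using BC by (simp add: add_mset_commute)
          then have "prov S l (?M + N + add_mset (Rgt C) ?M)"
            by (rule cut[OF _ B, rotated]) (simp add: Imp)
          then show ?thesis by (rule prov_set_mono) auto
        qed
        then have "prov S l (add_mset (Rgt C) (?M + N))" by simp
        then have "prov S l (?M + N + N)"
          by (rule cut[OF _ _ C, rotated]) (simp add: Imp)
        then show "prov S l (?M + N)" by (rule prov_set_mono) auto
      qed
      then show "prov S l (M + N)"
        by (rule prov_weaken_le) (auto simp: kept_context_def)
    qed (simp add: Imp)
  next
    case (All x B)
    show ?thesis
      using left
    proof (rule cut_reduce_left)
      fix Ps M
      assume Ps: "logical S l (Rgt A) Ps" "\<And>P. P \<in> Ps \<Longrightarrow> prov S l (P + kept_context l (Rgt A) M)"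
      have inst: "prov S l (add_mset (Rgt (subst_fm (Bound x) t B)) (kept_context l (Rgt A) M))"
        if "is_term S t" for t
        using that Ps(1) Ps(2)[of "{#Rgt (subst_fm (Bound x) t B)#}"] by (simp add: All logical_iffs)
      let ?M = "kept_context l (Rgt A) M"
      have "prov S l (?M + N)"
        using right
      proof (rule cut_reduce_right)
        show "l = Classical \<or> filter_mset is_left ?M = ?M" by (simp add: All kept_context_def multiset_eq_iff)
      next
        fix N :: "('a, 'b) signed_fm multiset"
        assume "axiomatic l (add_mset (Lft A) N)"
        then have "axiomatic l (?M + N)" by (rule axiomatic_mono) (auto simp: All)
        then show "prov S l (?M + N)" by (rule prov.axiom)
      next
        fix Qs N
        assume Qs: "logical S l (Lft A) Qs"
          "\<And>P. add_mset (Lft A) P \<in> Qs \<Longrightarrow> prov S l (?M + (P + N))"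
        then obtain t where t: "is_term S t"
          and "prov S l (?M + ({#Lft (subst_fm (Bound x) t B)#} + N))"
          by (auto simp: All logical_iffs)
        then have "prov S l (add_mset (Lft (subst_fm (Bound x) t B)) (?M + N))" by simp
        then have "prov S l (?M + (?M + N))" by (rule cut[OF _ inst[OF t], rotated]) (simp add: All)
        then show "prov S l (?M + N)" by (rule prov_set_mono) auto
      qed
      then show "prov S l (M + N)"
        by (rule prov_weaken_le) (auto simp: kept_context_def)
    qed (simp add: All)
  next
    case (Ex x B)
    have inst: "prov S l (add_mset (Lft (subst_fm (Bound x) t B)) N)" if "is_term S t" for t
    proof -
      have "prov S l ({#Lft (subst_fm (Bound x) t B)#} + N)"
        by (rule prov_invert[OF logical.LEx _ _ right[unfolded Ex]]) (use that in auto)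
      then show ?thesis by simp
    qed
    show ?thesis
      using left
    proof (rule cut_reduce_left)
      fix Ps M
      assume Ps: "logical S l (Rgt A) Ps"
        "\<And>P. add_mset (Rgt A) P \<in> Ps \<Longrightarrow> prov S l (P + kept_context l (Rgt A) M + N)"
      then obtain t where t: "is_term S t"
        and "prov S l ({#Rgt (subst_fm (Bound x) t B)#} + M + N)"
        by (auto simp: Ex logical_iffs)
      then have "prov S l (add_mset (Rgt (subst_fm (Bound x) t B)) (M + N))" by simp
      then have "prov S l (M + N + N)" by (rule cut[OF _ _ inst[OF t], rotated]) (simp add: Ex)
      then show "prov S l (M + N)" by (rule prov_set_mono) auto
    qed (simp add: Ex)
  qed
qed

section \<open>Instantiation of free variables\<close>

fun inst_tm :: "(nat \<Rightarrow> 'f tm) \<Rightarrow> 'f tm \<Rightarrow> 'f tm" where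
  "inst_tm \<sigma> (Var (Free a)) = \<sigma> a"
| "inst_tm \<sigma> (Var (Bound x)) = Var (Bound x)"
| "inst_tm \<sigma> (Fn f ts) = Fn f (map (inst_tm \<sigma>) ts)"

fun inst_fm :: "(nat \<Rightarrow> 'f tm) \<Rightarrow> ('f, 'p) fm \<Rightarrow> ('f, 'p) fm" where
  "inst_fm \<sigma> Falsum = Falsum"
| "inst_fm \<sigma> (Eq t u) = Eq (inst_tm \<sigma> t) (inst_tm \<sigma> u)"
| "inst_fm \<sigma> (Pred p ts) = Pred p (map (inst_tm \<sigma>) ts)"
| "inst_fm \<sigma> (Conj A B) = Conj (inst_fm \<sigma> A) (inst_fm \<sigma> B)"
| "inst_fm \<sigma> (Disj A B) = Disj (inst_fm \<sigma> A) (inst_fm \<sigma> B)"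
| "inst_fm \<sigma> (Imp A B) = Imp (inst_fm \<sigma> A) (inst_fm \<sigma> B)"
| "inst_fm \<sigma> (All x A) = All x (inst_fm \<sigma> A)"
| "inst_fm \<sigma> (Ex x A) = Ex x (inst_fm \<sigma> A)"

fun inst_seq :: "(nat \<Rightarrow> 'f tm) \<Rightarrow> ('f, 'p) seq \<Rightarrow> ('f, 'p) seq" where
  "inst_seq \<sigma> (\<Gamma> \<turnstile> \<Delta>) = (image_mset (inst_fm \<sigma>) \<Gamma> \<turnstile> image_mset (inst_fm \<sigma>) \<Delta>)"

lemma subst_bound_term: "wf_tm S {} t \<Longrightarrow> subst_tm (Bound x) u t = t"
proof (induction t)
  case (Var v)
  then show ?case by (cases v) auto
qed (auto intro: map_idI)

lemma inst_tm_cong: "(\<And>a. a \<in> fv_tm t \<Longrightarrow> \<sigma> a = \<tau> a) \<Longrightarrow> inst_tm \<sigma> t = inst_tm \<tau> t"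
proof (induction t)
  case (Var v)
  then show ?case by (cases v) auto
qed auto

lemma inst_fm_cong: "(\<And>a. a \<in> fv_fm A \<Longrightarrow> \<sigma> a = \<tau> a) \<Longrightarrow> inst_fm \<sigma> A = inst_fm \<tau> A"
  by (induction A) (auto intro: inst_tm_cong)

lemma inst_tm_id [simp]: "inst_tm (\<lambda>a. Var (Free a)) t = t"
proof (induction t)
  case (Var v)
  then show ?case by (cases v) auto
qed (auto intro: map_idI)

lemma inst_fm_id [simp]: "inst_fm (\<lambda>a. Var (Free a)) A = A"
  by (induction A) (auto intro: map_idI)

lemma inst_seq_id [simp]: "inst_seq (\<lambda>a. Var (Free a)) s = s"
proof -
  have "inst_fm (\<lambda>a. Var (Free a)) = (\<lambda>A :: ('a, 'b) fm. A)" by auto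
  then show ?thesis by (cases s) simp
qed

lemma inst_tm_term:
  assumes "\<And>a. is_term S (\<sigma> a)"
  shows "is_term S t \<Longrightarrow> is_term S (inst_tm \<sigma> t)"
  using assms unfolding is_term_def
proof (induction t)
  case (Var v)
  then show ?case by (cases v) auto
qed auto

lemma inst_tm_subst:
  assumes "\<And>a. is_term S (\<sigma> a)"
  shows "inst_tm \<sigma> (subst_tm (Bound x) t u) = subst_tm (Bound x) (inst_tm \<sigma> t) (inst_tm \<sigma> u)"
proof (induction u)
  case (Var v)
  have "subst_tm (Bound x) (inst_tm \<sigma> t) (\<sigma> a) = \<sigma> a" for a
    using assms[of a] by (intro subst_bound_term) (simp add: is_term_def)
  then show ?case by (cases v) auto
qed auto

lemma inst_fm_subst:
  assumes "\<And>a. is_term S (\<sigma> a)"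
  shows "inst_fm \<sigma> (subst_fm (Bound x) t A) = subst_fm (Bound x) (inst_tm \<sigma> t) (inst_fm \<sigma> A)"
  by (induction A) (auto simp: inst_tm_subst[OF assms])

lemma eqv_inst:
  assumes "eqv E t u" "\<And>t u. (t, u) \<in> E \<Longrightarrow> (inst_tm \<sigma> t, inst_tm \<sigma> u) \<in> E'"
  shows "eqv E' (inst_tm \<sigma> t) (inst_tm \<sigma> u)"
  using assms(1)
proof induction
  case (base t u)
  then show ?case by (intro eqv.base assms(2))
next
  case (refl t)
  show ?case by (rule eqv.refl)
next
  case (sym t u)
  from sym.IH show ?case by (rule eqv.sym)
next
  case (trans t u v)
  from trans.IH show ?case by (rule eqv.trans)
next
  case (cong ts us f)
  then have "list_all2 (eqv E') (map (inst_tm \<sigma>) ts) (map (inst_tm \<sigma>) us)"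
    by (simp add: list_all2_conv_all_nth)
  then show ?case by (simp add: eqv.cong)
qed

text \<open>Consequence in the theory of equality is closed under substitution for free variables.\<close>

lemma entails_inst:
  assumes "entails G A"
  shows "entails (inst_fm \<sigma> ` G) (inst_fm \<sigma> A)"
proof -
  have eq: "eqv (equations (inst_fm \<sigma> ` G)) (inst_tm \<sigma> t) (inst_tm \<sigma> u)"
    if "eqv (equations G) t u" for t u
    using that by (rule eqv_inst) (force simp: equations_def)
  show ?thesis
  proof (cases A)
    case Falsum
    then show ?thesis using assms by force
  next
    case (Eq t u)
    then show ?thesis using assms eq by simp
  next
    case (Pred p us)
    then obtain ts where "Pred p ts \<in> G" "list_all2 (eqv (equations G)) ts us"
      using assms by auto
    then have "Pred p (map (inst_tm \<sigma>) ts) \<in> inst_fm \<sigma> ` G"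
      and "list_all2 (eqv (equations (inst_fm \<sigma> ` G))) (map (inst_tm \<sigma>) ts) (map (inst_tm \<sigma>) us)"
      using eq by (force, simp add: list_all2_conv_all_nth)
    then show ?thesis using Pred by auto
  qed (use assms in simp_all)
qed

lemma axiomatic_inst: "axiomatic l (signed s) \<Longrightarrow> axiomatic l (signed (inst_seq \<sigma> s))"
  by (cases s) (force simp: axiomatic_signed simp del: signed.simps dest: entails_inst[of _ _ \<sigma>])

section \<open>Translating derivations into the calculus of axiomatic leaves\<close>

lemma kept_context_signed:
  "kept_context l F (signed (\<Gamma> \<turnstile> \<Delta>)) = signed (\<Gamma> \<turnstile> (if drops_succedents l F then {#} else \<Delta>))"
  by (auto simp: kept_context_def filter_mset_image_mset comp_def)

lemma prov_left:
  assumes "logical S l (Lft A) Ps" "\<And>P. P \<in> Ps \<Longrightarrow> prov S l (P + signed (\<Gamma> \<turnstile> \<Delta>))"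
  shows "prov S l (signed (add_mset A \<Gamma> \<turnstile> \<Delta>))"
  using prov.step[OF assms(1), of "signed (\<Gamma> \<turnstile> \<Delta>)"] assms(2) by simp

lemma prov_right:
  assumes "logical S l (Rgt A) Ps"
    and "\<And>P. P \<in> Ps \<Longrightarrow> prov S l (P + signed (\<Gamma> \<turnstile> (if drops_succedents l (Rgt A) then {#} else \<Delta>)))"
  shows "prov S l (signed (\<Gamma> \<turnstile> add_mset A \<Delta>))"
  using prov.step[OF assms(1), of "signed (\<Gamma> \<turnstile> \<Delta>)"] assms(2)
  unfolding kept_context_signed by simp

text \<open>Quantifying over all instances is what turns an eigenvariable premiss into premisses for all terms:
the eigenvariable is simply mapped to the term in question.\<close>

definition instances_provable :: "('f, 'p) signature \<Rightarrow> logic \<Rightarrow> ('f, 'p) seq \<Rightarrow> bool" where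
  "instances_provable S l s \<longleftrightarrow> (\<forall>\<sigma>. (\<forall>a. is_term S (\<sigma> a)) \<longrightarrow> prov S l (signed (inst_seq \<sigma> s)))"

lemma logical_rule_sound:
  fixes S :: "('f, 'p) signature"
  assumes "\<rho> \<in> common_rules S \<union> specific_rules l" "(ps, c) \<in> \<rho>"
    and prems: "\<And>p. p \<in> set ps \<Longrightarrow> instances_provable S l p"
  shows "instances_provable S l c"
  unfolding instances_provable_def
proof (intro allI impI)
  fix \<sigma> :: "nat \<Rightarrow> 'f tm"
  assume \<sigma>: "\<forall>a. is_term S (\<sigma> a)"
  have prem: "prov S l (signed (inst_seq \<sigma> p))" if "p \<in> set ps" for p
    using prems[OF that] \<sigma> unfolding instances_provable_def by blast
  \<comment> \<open>All instances of a premiss are provable, so its eigenvariable may stand for any term.\<close>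
  have eigen: "prov S l (signed (inst_seq (\<sigma>(a := t)) p))" if "p \<in> set ps" "is_term S t" for a t p
    using prems[OF that(1)] \<sigma> that(2) unfolding instances_provable_def by simp
  have fresh: "inst_fm (\<sigma>(a := t)) A = inst_fm \<sigma> A" if "a \<notin> fv_fm A" for a t and A :: "('f, 'p) fm"
    using that by (intro inst_fm_cong) auto
  have fresh_context: "image_mset (inst_fm (\<sigma>(a := t))) \<Gamma> = image_mset (inst_fm \<sigma>) \<Gamma>"
    if "\<And>A. A \<in># \<Gamma> \<Longrightarrow> a \<notin> fv_fm A" for a t and \<Gamma> :: "('f, 'p) fm multiset"
    using that by (intro image_mset_cong) (auto intro: fresh)
  have eigen_inst: "inst_fm (\<sigma>(a := t)) (subst_fm (Bound x) (Var (Free a)) A)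
      = subst_fm (Bound x) t (inst_fm \<sigma> A)" if "is_term S t" "a \<notin> fv_fm A" for a t x and A :: "('f, 'p) fm"
    using \<sigma> that inst_fm_subst[of S "\<sigma>(a := t)" x "Var (Free a)" A] fresh by auto
  note inst_subst = inst_fm_subst[of S \<sigma>, OF \<sigma>[rule_format]]
  note inst_term = inst_tm_term[of S \<sigma>, OF \<sigma>[rule_format]]
  consider "\<rho> = L_conj"
    | "\<rho> = R_conj"
    | "\<rho> = L_disj"
    | "\<rho> = R_disj"
    | "\<rho> = L_all S"
    | "\<rho> = R_ex S"
    | "\<rho> = L_ex"
    | "l \<noteq> Classical" "\<rho> = Li_imp"
    | "l \<noteq> Classical" "\<rho> = Ri_imp"
    | "l \<noteq> Classical" "\<rho> = Ri_all"
    | "l = Classical" "\<rho> = L_imp"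
    | "l = Classical" "\<rho> = R_imp"
    | "l = Classical" "\<rho> = R_all"
    using assms(1) by (cases l) (auto simp: common_rules_def)
  then show "prov S l (signed (inst_seq \<sigma> c))"
  proof cases
    case 1
    then obtain A B \<Gamma> \<Delta> where c: "c = (add_mset (Conj A B) \<Gamma> \<turnstile> \<Delta>)"
      and ps: "ps = [add_mset A (add_mset B \<Gamma>) \<turnstile> \<Delta>]"
      using assms(2) by (auto simp: L_conj_def)
    have prem': "prov S l (signed (inst_seq \<sigma> (add_mset A (add_mset B \<Gamma>) \<turnstile> \<Delta>)))"
      by (rule prem; simp add: ps)+
    show ?thesis
      unfolding c inst_seq.simps inst_fm.simps image_mset_add_mset
      by (rule prov_left[OF logical.LConj]) (use prem' in \<open>auto simp: add_mset_commute\<close>)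
  next
    case 2
    then obtain A B \<Gamma> \<Delta> where c: "c = (\<Gamma> \<turnstile> add_mset (Conj A B) \<Delta>)"
      and ps: "ps = [\<Gamma> \<turnstile> add_mset A \<Delta>, \<Gamma> \<turnstile> add_mset B \<Delta>]"
      using assms(2) by (auto simp: R_conj_def)
    have prem': "prov S l (signed (inst_seq \<sigma> (\<Gamma> \<turnstile> add_mset A \<Delta>)))"
      "prov S l (signed (inst_seq \<sigma> (\<Gamma> \<turnstile> add_mset B \<Delta>)))"
      by (rule prem; simp add: ps)+
    show ?thesis
      unfolding c inst_seq.simps inst_fm.simps image_mset_add_mset
      by (rule prov_right[OF logical.RConj]) (use prem' in \<open>auto simp: add_mset_commute\<close>)
  next
    case 3
    then obtain A B \<Gamma> \<Delta> where c: "c = (add_mset (Disj A B) \<Gamma> \<turnstile> \<Delta>)"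
      and ps: "ps = [add_mset A \<Gamma> \<turnstile> \<Delta>, add_mset B \<Gamma> \<turnstile> \<Delta>]"
      using assms(2) by (auto simp: L_disj_def)
    have prem': "prov S l (signed (inst_seq \<sigma> (add_mset A \<Gamma> \<turnstile> \<Delta>)))"
      "prov S l (signed (inst_seq \<sigma> (add_mset B \<Gamma> \<turnstile> \<Delta>)))"
      by (rule prem; simp add: ps)+
    show ?thesis
      unfolding c inst_seq.simps inst_fm.simps image_mset_add_mset
      by (rule prov_left[OF logical.LDisj]) (use prem' in \<open>auto simp: add_mset_commute\<close>)
  next
    case 4
    then obtain A B \<Gamma> \<Delta> where c: "c = (\<Gamma> \<turnstile> add_mset (Disj A B) \<Delta>)"
      and ps: "ps = [\<Gamma> \<turnstile> add_mset A (add_mset B \<Delta>)]"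
      using assms(2) by (auto simp: R_disj_def)
    have prem': "prov S l (signed (inst_seq \<sigma> (\<Gamma> \<turnstile> add_mset A (add_mset B \<Delta>))))"
      by (rule prem; simp add: ps)+
    show ?thesis
      unfolding c inst_seq.simps inst_fm.simps image_mset_add_mset
      by (rule prov_right[OF logical.RDisj]) (use prem' in \<open>auto simp: add_mset_commute\<close>)
  next
    case 5
    then obtain x t A \<Gamma> \<Delta> where c: "c = (add_mset (All x A) \<Gamma> \<turnstile> \<Delta>)"
      and ps: "ps = [add_mset (subst_fm (Bound x) t A) (add_mset (All x A) \<Gamma>) \<turnstile> \<Delta>]" and t: "is_term S t"
      using assms(2) by (auto simp: L_all_def)
    have prem': "prov S l (signed (inst_seq \<sigma> (add_mset (subst_fm (Bound x) t A) (add_mset (All x A) \<Gamma>) \<turnstile> \<Delta>)))"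
      by (rule prem; simp add: ps)+
    show ?thesis
      unfolding c inst_seq.simps inst_fm.simps image_mset_add_mset
      by (rule prov_left[OF logical.LAll[OF inst_term[OF t]]]) (use prem' in \<open>auto simp: inst_subst add_mset_commute\<close>)
  next
    case 6
    then obtain x t A \<Gamma> \<Delta> where c: "c = (\<Gamma> \<turnstile> add_mset (Ex x A) \<Delta>)"
      and ps: "ps = [\<Gamma> \<turnstile> add_mset (Ex x A) (add_mset (subst_fm (Bound x) t A) \<Delta>)]" and t: "is_term S t"
      using assms(2) by (auto simp: R_ex_def)
    have prem': "prov S l (signed (inst_seq \<sigma> (\<Gamma> \<turnstile> add_mset (Ex x A) (add_mset (subst_fm (Bound x) t A) \<Delta>))))"
      by (rule prem; simp add: ps)+
    show ?thesis
      unfolding c inst_seq.simps inst_fm.simps image_mset_add_mset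
      by (rule prov_right[OF logical.REx[OF inst_term[OF t]]]) (use prem' in \<open>auto simp: inst_subst add_mset_commute\<close>)
  next
    case 7
    then obtain x a A \<Gamma> \<Delta> where c: "c = (add_mset (Ex x A) \<Gamma> \<turnstile> \<Delta>)"
      and ps: "ps = [add_mset (subst_fm (Bound x) (Var (Free a)) A) \<Gamma> \<turnstile> \<Delta>]"
      and a: "a \<notin> fv_seq (add_mset (Ex x A) \<Gamma> \<turnstile> \<Delta>)"
      using assms(2) by (auto simp: L_ex_def)
    have a': "a \<notin> fv_fm A" "\<And>B. B \<in># \<Gamma> \<Longrightarrow> a \<notin> fv_fm B" "\<And>B. B \<in># \<Delta> \<Longrightarrow> a \<notin> fv_fm B"
      using a by (auto simp: fv_seq_def)
    have prem': "is_term S t \<Longrightarrow> prov S l (signed (inst_seq (\<sigma>(a := t)) (add_mset (subst_fm (Bound x) (Var (Free a)) A) \<Gamma> \<turnstile> \<Delta>)))" for t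
      by (rule eigen) (simp_all add: ps)
    show ?thesis
      unfolding c inst_seq.simps inst_fm.simps image_mset_add_mset
      by (rule prov_left[OF logical.LEx]) 
      (use prem' in \<open>auto simp: eigen_inst[OF _ a'(1)] fresh_context[OF a'(2)] fresh_context[OF a'(3)] ac_simps\<close>)
  next
    case 8
    then obtain A B \<Gamma> \<Delta> where c: "c = (add_mset (Imp A B) \<Gamma> \<turnstile> \<Delta>)"
      and ps: "ps = [add_mset (Imp A B) \<Gamma> \<turnstile> add_mset A \<Delta>, add_mset B \<Gamma> \<turnstile> \<Delta>]"
      using assms(2) by (auto simp: Li_imp_def)
    have prem': "prov S l (signed (inst_seq \<sigma> (add_mset (Imp A B) \<Gamma> \<turnstile> add_mset A \<Delta>)))"
      "prov S l (signed (inst_seq \<sigma> (add_mset B \<Gamma> \<turnstile> \<Delta>)))"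
      by (rule prem; simp add: ps)+
    show ?thesis
      unfolding c inst_seq.simps inst_fm.simps image_mset_add_mset
      by (rule prov_left[OF logical.LImp]) (use prem' 8(1) in \<open>auto simp: add_mset_commute\<close>)
  next
    case 9
    then obtain A B \<Gamma> \<Delta> where c: "c = (\<Gamma> \<turnstile> add_mset (Imp A B) \<Delta>)"
      and ps: "ps = [add_mset A \<Gamma> \<turnstile> {#B#}]"
      using assms(2) by (auto simp: Ri_imp_def)
    have prem': "prov S l (signed (inst_seq \<sigma> (add_mset A \<Gamma> \<turnstile> {#B#})))"
      by (rule prem; simp add: ps)+
    show ?thesis
      unfolding c inst_seq.simps inst_fm.simps image_mset_add_mset
      by (rule prov_right[OF logical.RImp]) (use prem' 9(1) in \<open>auto simp: add_mset_commute\<close>)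
  next
    case 10
    then obtain x a A \<Gamma> \<Delta> where c: "c = (\<Gamma> \<turnstile> add_mset (All x A) \<Delta>)"
      and ps: "ps = [\<Gamma> \<turnstile> {#subst_fm (Bound x) (Var (Free a)) A#}]"
      and a: "a \<notin> fv_seq (\<Gamma> \<turnstile> add_mset (All x A) \<Delta>)"
      using assms(2) by (auto simp: Ri_all_def)
    have a': "a \<notin> fv_fm A" "\<And>B. B \<in># \<Gamma> \<Longrightarrow> a \<notin> fv_fm B" "\<And>B. B \<in># \<Delta> \<Longrightarrow> a \<notin> fv_fm B"
      using a by (auto simp: fv_seq_def)
    have prem': "is_term S t \<Longrightarrow> prov S l (signed (inst_seq (\<sigma>(a := t)) (\<Gamma> \<turnstile> {#subst_fm (Bound x) (Var (Free a)) A#})))" for t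
      by (rule eigen) (simp_all add: ps)
    show ?thesis
      unfolding c inst_seq.simps inst_fm.simps image_mset_add_mset
      by (rule prov_right[OF logical.RAll]) 
      (use prem' 10(1) in \<open>auto simp: eigen_inst[OF _ a'(1)] fresh_context[OF a'(2)] ac_simps\<close>)
  next
    case 11
    then obtain A B \<Gamma> \<Delta> where c: "c = (add_mset (Imp A B) \<Gamma> \<turnstile> \<Delta>)"
      and ps: "ps = [\<Gamma> \<turnstile> add_mset A \<Delta>, add_mset B \<Gamma> \<turnstile> \<Delta>]"
      using assms(2) by (auto simp: L_imp_def)
    have prem': "prov S l (signed (inst_seq \<sigma> (\<Gamma> \<turnstile> add_mset A \<Delta>)))"
      "prov S l (signed (inst_seq \<sigma> (add_mset B \<Gamma> \<turnstile> \<Delta>)))"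
      by (rule prem; simp add: ps)+
    show ?thesis
      unfolding c inst_seq.simps inst_fm.simps image_mset_add_mset
      by (rule prov_left[OF logical.LImp]) (use prem' 11(1) in \<open>auto simp: add_mset_commute\<close>)
  next
    case 12
    then obtain A B \<Gamma> \<Delta> where c: "c = (\<Gamma> \<turnstile> add_mset (Imp A B) \<Delta>)"
      and ps: "ps = [add_mset A \<Gamma> \<turnstile> add_mset B \<Delta>]"
      using assms(2) by (auto simp: R_imp_def)
    have prem': "prov S l (signed (inst_seq \<sigma> (add_mset A \<Gamma> \<turnstile> add_mset B \<Delta>)))"
      by (rule prem; simp add: ps)+
    show ?thesis
      unfolding c inst_seq.simps inst_fm.simps image_mset_add_mset
      by (rule prov_right[OF logical.RImp]) (use prem' 12(1) in \<open>auto simp: add_mset_commute\<close>)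
  next
    case 13
    then obtain x a A \<Gamma> \<Delta> where c: "c = (\<Gamma> \<turnstile> add_mset (All x A) \<Delta>)"
      and ps: "ps = [\<Gamma> \<turnstile> add_mset (subst_fm (Bound x) (Var (Free a)) A) \<Delta>]"
      and a: "a \<notin> fv_seq (\<Gamma> \<turnstile> add_mset (All x A) \<Delta>)"
      using assms(2) by (auto simp: R_all_def)
    have a': "a \<notin> fv_fm A" "\<And>B. B \<in># \<Gamma> \<Longrightarrow> a \<notin> fv_fm B" "\<And>B. B \<in># \<Delta> \<Longrightarrow> a \<notin> fv_fm B"
      using a by (auto simp: fv_seq_def)
    have prem': "is_term S t \<Longrightarrow> prov S l (signed (inst_seq (\<sigma>(a := t)) (\<Gamma> \<turnstile> add_mset (subst_fm (Bound x) (Var (Free a)) A) \<Delta>)))" for t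
      by (rule eigen) (simp_all add: ps)
    show ?thesis
      unfolding c inst_seq.simps inst_fm.simps image_mset_add_mset
      by (rule prov_right[OF logical.RAll]) 
      (use prem' 13(1) in \<open>auto simp: eigen_inst[OF _ a'(1)] fresh_context[OF a'(2)] fresh_context[OF a'(3)] ac_simps\<close>)
  qed
qed

lemma inst_seq_simps:
  "signed (inst_seq \<sigma> (add_mset A \<Gamma> \<turnstile> \<Delta>)) = add_mset (Lft (inst_fm \<sigma> A)) (signed (inst_seq \<sigma> (\<Gamma> \<turnstile> \<Delta>)))"
  "signed (inst_seq \<sigma> (\<Gamma> \<turnstile> add_mset A \<Delta>)) = add_mset (Rgt (inst_fm \<sigma> A)) (signed (inst_seq \<sigma> (\<Gamma> \<turnstile> \<Delta>)))"
  by simp_all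

text \<open>The equality rules are simulated by cuts against axiomatic sequents, which is where cut for the
calculus of axiomatic leaves enters.\<close>

theorem calculus_sound:
  assumes "derivable S (G3 S l \<union> R12_rlplus_prec prec) s"
  shows "instances_provable S l s"
  using assms
proof (induction rule: derivable.induct)
  case (step \<rho> ps c)
  consider "\<rho> \<in> initial l" | "\<rho> \<in> common_rules S \<union> specific_rules l"
    | Q where "\<rho> \<in> {Ref, Rep_r1 Q, Rep_r2 Q, Rep_lplus1 Q, Rep_lplus2 Q}"
    using step.hyps(1) by (auto simp: G3_def R12_rlplus_prec_def)
  then show ?case
  proof cases
    case 1
    then show ?thesis
      using step.hyps(2) axiomatic_initial
      unfolding instances_provable_def by (blast intro: prov.axiom axiomatic_inst)
  next
    case 2
    then show ?thesis using step.hyps(2) step.IH by (rule logical_rule_sound)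
  next
    case (3 Q)
    show ?thesis
    proof (rule equality_rule_closed[where D = "instances_provable S l", OF _ _ _ 3 step.hyps(2)])
      fix \<Gamma> \<Delta> \<Gamma>' \<Delta>' :: "('a, 'b) fm multiset"
      assume der: "instances_provable S l (\<Gamma> \<turnstile> \<Delta>)"
        and sub: "set_mset \<Gamma> \<subseteq> set_mset \<Gamma>'" "set_mset \<Delta> \<subseteq> set_mset \<Delta>'"
      have "set_mset (signed (inst_seq \<sigma> (\<Gamma> \<turnstile> \<Delta>))) \<subseteq> set_mset (signed (inst_seq \<sigma> (\<Gamma>' \<turnstile> \<Delta>')))" for \<sigma>
        using sub by auto
      then show "instances_provable S l (\<Gamma>' \<turnstile> \<Delta>')"
        using der prov_set_mono unfolding instances_provable_def by blast
    next
      fix A and \<Gamma> \<Delta> :: "('a, 'b) fm multiset"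
      assume prems: "instances_provable S l (\<Gamma> \<turnstile> add_mset A \<Delta>)" "instances_provable S l (add_mset A \<Gamma> \<turnstile> \<Delta>)"
      show "instances_provable S l (\<Gamma> \<turnstile> \<Delta>)"
        unfolding instances_provable_def
      proof (intro allI impI)
        fix \<sigma> :: "nat \<Rightarrow> 'a tm"
        assume "\<forall>a. is_term S (\<sigma> a)"
        then have "prov S l (signed (inst_seq \<sigma> (\<Gamma> \<turnstile> \<Delta>)) + signed (inst_seq \<sigma> (\<Gamma> \<turnstile> \<Delta>)))"
          using prems unfolding instances_provable_def inst_seq_simps by (blast intro: prov_cut)
        then show "prov S l (signed (inst_seq \<sigma> (\<Gamma> \<turnstile> \<Delta>)))"
          by (rule prov_set_mono) simp
      qed
    next
      fix A and \<Gamma> \<Delta> :: "('a, 'b) fm multiset"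
      assume "entails (set_mset \<Gamma>) A"
      then have "axiomatic l (signed (\<Gamma> \<turnstile> add_mset A \<Delta>))"
        unfolding axiomatic_signed by auto
      then show "instances_provable S l (\<Gamma> \<turnstile> add_mset A \<Delta>)"
        unfolding instances_provable_def by (blast intro: prov.axiom axiomatic_inst)
    qed (use step.IH in blast)
  qed
qed

section \<open>Translating back\<close>

lemma wf_tm_mono: "wf_tm S B t \<Longrightarrow> B \<subseteq> B' \<Longrightarrow> wf_tm S B' t"
proof (induction t)
  case (Var v)
  then show ?case by (cases v) auto
qed auto

lemma wf_tm_subst:
  "wf_tm S (insert x B) u \<Longrightarrow> is_term S t \<Longrightarrow> wf_tm S B (subst_tm (Bound x) t u)"
proof (induction u)
  case (Var v)
  then show ?case using wf_tm_mono[of S "{}" t B] by (cases v) (auto simp: is_term_def)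
qed auto

lemma wf_fm_subst:
  "wf_fm S (insert x B) A \<Longrightarrow> is_term S t \<Longrightarrow> wf_fm S B (subst_fm (Bound x) t A)"
proof (induction A arbitrary: B)
  case (All y A)
  then show ?case using All.IH[of "insert y B"] by (auto simp: insert_commute)
next
  case (Ex y A)
  then show ?case using Ex.IH[of "insert y B"] by (auto simp: insert_commute)
qed (auto intro: wf_tm_subst)

lemma is_formula_simps [simp]:
  "is_formula S (Conj A B) \<longleftrightarrow> is_formula S A \<and> is_formula S B"
  "is_formula S (Disj A B) \<longleftrightarrow> is_formula S A \<and> is_formula S B"
  "is_formula S (Imp A B) \<longleftrightarrow> is_formula S A \<and> is_formula S B"
  by (simp_all add: is_formula_def)

lemma is_formula_instance:
  "is_formula S (All x A) \<or> is_formula S (Ex x A) \<Longrightarrow> is_term S t \<Longrightarrow> is_formula S (subst_fm (Bound x) t A)"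
  by (auto simp: is_formula_def intro: wf_fm_subst)

lemma finite_fv_fm [simp]: "finite (fv_fm A)"
  by (induction A) auto

lemma obtain_eigenvariable: obtains a where "a \<notin> fv_seq s"
  using ex_new_if_finite[OF infinite_UNIV_nat, of "fv_seq s"] by (auto simp: fv_seq_def)

lemma is_term_Free [simp]: "is_term S (Var (Free a))"
  by (simp add: is_term_def)

lemma signed_eq_add:
  assumes "signed (\<Gamma> \<turnstile> \<Delta>) = add_mset F M"
  obtains A \<Gamma>' where "F = Lft A" "\<Gamma> = add_mset A \<Gamma>'" "M = signed (\<Gamma>' \<turnstile> \<Delta>)"
  | A \<Delta>' where "F = Rgt A" "\<Delta> = add_mset A \<Delta>'" "M = signed (\<Gamma> \<turnstile> \<Delta>')"
proof -
  have "F \<in># signed (\<Gamma> \<turnstile> \<Delta>)" using assms by simp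
  then consider A where "F = Lft A" "A \<in># \<Gamma>" | A where "F = Rgt A" "A \<in># \<Delta>" by auto
  then show thesis
  proof cases
    case (1 A)
    then obtain \<Gamma>' where "\<Gamma> = add_mset A \<Gamma>'" by (metis mset_add)
    then show thesis using that(1) 1 assms by simp
  next
    case (2 A)
    then obtain \<Delta>' where "\<Delta> = add_mset A \<Delta>'" by (metis mset_add)
    then show thesis using that(2) 2 assms by simp
  qed
qed

text \<open>The logical rules are applied one by one; a family of premisses indexed by terms is used at a variable
that does not occur in the conclusion. The leaves are derived by the restricted equality rules.\<close>

theorem calculus_complete:
  assumes "prov S l M" "M = signed (\<Gamma> \<turnstile> \<Delta>)" "is_sequent S (\<Gamma> \<turnstile> \<Delta>)"
  shows "derivable S (G3 S l \<union> R12_rlplus_prec prec) (\<Gamma> \<turnstile> \<Delta>)"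
  using assms
proof (induction arbitrary: \<Gamma> \<Delta> rule: prov.induct)
  case (axiom M)
  then show ?case by (intro restricted_complete[of l _ _ S _ prec]) (auto simp: G3_def)
next
  case (step F Ps M)
  let ?C = "G3 S l \<union> R12_rlplus_prec prec"
  have rules: "{L_conj, R_conj, L_disj, R_disj, L_all S, L_ex, R_ex S} \<subseteq> ?C"
    "if l = Classical then {L_imp, R_imp, R_all} \<subseteq> ?C else {Li_imp, Ri_imp, Ri_all} \<subseteq> ?C"
    by (cases l; simp add: G3_def common_rules_def)+
  from step.prems(1)[symmetric] show ?case
  proof (cases rule: signed_eq_add)
    case (1 A \<Gamma>')
    have wf: "formulas S \<Gamma>'" "formulas S \<Delta>" "is_formula S A"
      using step.prems(2) 1 by (simp_all add: is_sequent_formulas)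
    have prem: "derivable S ?C (\<Gamma>1 \<turnstile> \<Delta>1)"
      if "P \<in> Ps" "P + signed (\<Gamma>' \<turnstile> \<Delta>) = signed (\<Gamma>1 \<turnstile> \<Delta>1)" "formulas S \<Gamma>1" "formulas S \<Delta>1" for P \<Gamma>1 \<Delta>1
      using step.IH[OF that(1)] that(2-) 1 by (simp add: is_sequent_formulas del: signed.simps)
    from step.hyps(1)[unfolded 1(1)] show ?thesis
    proof cases
      case (LConj B C)
      show ?thesis
        unfolding 1(2)
      proof (rule derivable_single)
        show "derivable S ?C (add_mset B (add_mset C \<Gamma>') \<turnstile> \<Delta>)"
          using wf by (intro prem[of "{#Lft B, Lft C#}"]) (auto simp: LConj)
        show "L_conj \<in> ?C" using rules by simp
        show "([add_mset B (add_mset C \<Gamma>') \<turnstile> \<Delta>], add_mset A \<Gamma>' \<turnstile> \<Delta>) \<in> L_conj"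
          unfolding LConj L_conj_def by blast
      qed (use step.prems(2) 1 in simp)
    next
      case (LDisj B C)
      show ?thesis
        unfolding 1(2)
      proof (rule derivable_double)
        show "derivable S ?C (add_mset B \<Gamma>' \<turnstile> \<Delta>)"
          using wf by (intro prem[of "{#Lft B#}"]) (auto simp: LDisj)
        show "derivable S ?C (add_mset C \<Gamma>' \<turnstile> \<Delta>)"
          using wf by (intro prem[of "{#Lft C#}"]) (auto simp: LDisj)
        show "L_disj \<in> ?C" using rules by simp
        show "([add_mset B \<Gamma>' \<turnstile> \<Delta>, add_mset C \<Gamma>' \<turnstile> \<Delta>], add_mset A \<Gamma>' \<turnstile> \<Delta>) \<in> L_disj"
          unfolding LDisj L_disj_def by blast
      qed (use step.prems(2) 1 in simp)
    next
      case (LImp B C)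
      have right: "derivable S ?C (add_mset C \<Gamma>' \<turnstile> \<Delta>)"
        using wf by (intro prem[of "{#Lft C#}"]) (auto simp: LImp)
      show ?thesis
      proof (cases "l = Classical")
        case True
        show ?thesis
          unfolding 1(2)
        proof (rule derivable_double[OF _ right])
          show "derivable S ?C (\<Gamma>' \<turnstile> add_mset B \<Delta>)"
            using wf True by (intro prem[of "{#Rgt B#}"]) (auto simp: LImp)
          show "L_imp \<in> ?C" using rules True by simp
          show "([\<Gamma>' \<turnstile> add_mset B \<Delta>, add_mset C \<Gamma>' \<turnstile> \<Delta>], add_mset A \<Gamma>' \<turnstile> \<Delta>) \<in> L_imp"
            unfolding LImp L_imp_def by blast
        qed (use step.prems(2) 1 in simp)
      next
        case False
        show ?thesis
          unfolding 1(2)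
        proof (rule derivable_double[OF _ right])
          show "derivable S ?C (add_mset A \<Gamma>' \<turnstile> add_mset B \<Delta>)"
            using wf False by (intro prem[of "{#Lft A, Rgt B#}"]) (auto simp: LImp)
          show "Li_imp \<in> ?C" using rules False by simp
          show "([add_mset A \<Gamma>' \<turnstile> add_mset B \<Delta>, add_mset C \<Gamma>' \<turnstile> \<Delta>], add_mset A \<Gamma>' \<turnstile> \<Delta>) \<in> Li_imp"
            unfolding LImp Li_imp_def by blast
        qed (use step.prems(2) 1 in simp)
      qed
    next
      case (LAll t x B)
      show ?thesis
        unfolding 1(2)
      proof (rule derivable_single)
        show "derivable S ?C (add_mset (subst_fm (Bound x) t B) (add_mset A \<Gamma>') \<turnstile> \<Delta>)"
          using wf is_formula_instance[of S x B t] LAll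
          by (intro prem[of "{#Lft A, Lft (subst_fm (Bound x) t B)#}"]) (auto simp: add_mset_commute)
        show "L_all S \<in> ?C" using rules by simp
        show "([add_mset (subst_fm (Bound x) t B) (add_mset A \<Gamma>') \<turnstile> \<Delta>], add_mset A \<Gamma>' \<turnstile> \<Delta>) \<in> L_all S"
          unfolding LAll L_all_def using LAll(3) by blast
      qed (use step.prems(2) 1 in simp)
    next
      case (LEx x B)
      obtain a where a: "a \<notin> fv_seq (add_mset A \<Gamma>' \<turnstile> \<Delta>)" by (rule obtain_eigenvariable)
      show ?thesis
        unfolding 1(2)
      proof (rule derivable_single)
        show "derivable S ?C (add_mset (subst_fm (Bound x) (Var (Free a)) B) \<Gamma>' \<turnstile> \<Delta>)"
          using wf is_formula_instance[of S x B "Var (Free a)"] LEx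
          by (intro prem[of "{#Lft (subst_fm (Bound x) (Var (Free a)) B)#}"]) auto
        show "L_ex \<in> ?C" using rules by simp
        show "([add_mset (subst_fm (Bound x) (Var (Free a)) B) \<Gamma>' \<turnstile> \<Delta>], add_mset A \<Gamma>' \<turnstile> \<Delta>) \<in> L_ex"
          using a unfolding LEx L_ex_def by blast
      qed (use step.prems(2) 1 in simp)
    qed
  next
    case (2 A \<Delta>')
    have wf: "formulas S \<Gamma>" "formulas S \<Delta>'" "is_formula S A"
      using step.prems(2) 2 by (simp_all add: is_sequent_formulas)
    have prem: "derivable S ?C (\<Gamma>1 \<turnstile> \<Delta>1)"
      if "P \<in> Ps" "P + signed (\<Gamma> \<turnstile> (if drops_succedents l (Rgt A) then {#} else \<Delta>')) = signed (\<Gamma>1 \<turnstile> \<Delta>1)"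
        "formulas S \<Gamma>1" "formulas S \<Delta>1" for P \<Gamma>1 \<Delta>1
      using step.IH[OF that(1)] that(2-) 2 kept_context_signed[of l F \<Gamma> \<Delta>']
      by (simp add: is_sequent_formulas del: signed.simps)
    from step.hyps(1)[unfolded 2(1)] show ?thesis
    proof cases
      case (RConj B C)
      show ?thesis
        unfolding 2(2)
      proof (rule derivable_double)
        show "derivable S ?C (\<Gamma> \<turnstile> add_mset B \<Delta>')"
          using wf by (intro prem[of "{#Rgt B#}"]) (auto simp: RConj)
        show "derivable S ?C (\<Gamma> \<turnstile> add_mset C \<Delta>')"
          using wf by (intro prem[of "{#Rgt C#}"]) (auto simp: RConj)
        show "R_conj \<in> ?C" using rules by simp
        show "([\<Gamma> \<turnstile> add_mset B \<Delta>', \<Gamma> \<turnstile> add_mset C \<Delta>'], \<Gamma> \<turnstile> add_mset A \<Delta>') \<in> R_conj"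
          unfolding RConj R_conj_def by blast
      qed (use step.prems(2) 2 in simp)
    next
      case (RDisj B C)
      show ?thesis
        unfolding 2(2)
      proof (rule derivable_single)
        show "derivable S ?C (\<Gamma> \<turnstile> add_mset B (add_mset C \<Delta>'))"
          using wf by (intro prem[of "{#Rgt B, Rgt C#}"]) (auto simp: RDisj)
        show "R_disj \<in> ?C" using rules by simp
        show "([\<Gamma> \<turnstile> add_mset B (add_mset C \<Delta>')], \<Gamma> \<turnstile> add_mset A \<Delta>') \<in> R_disj"
          unfolding RDisj R_disj_def by blast
      qed (use step.prems(2) 2 in simp)
    next
      case (RImp B C)
      show ?thesis
      proof (cases "l = Classical")
        case True
        show ?thesis
          unfolding 2(2)
        proof (rule derivable_single)
          show "derivable S ?C (add_mset B \<Gamma> \<turnstile> add_mset C \<Delta>')"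
            using wf True by (intro prem[of "{#Lft B, Rgt C#}"]) (auto simp: RImp)
          show "R_imp \<in> ?C" using rules True by simp
          show "([add_mset B \<Gamma> \<turnstile> add_mset C \<Delta>'], \<Gamma> \<turnstile> add_mset A \<Delta>') \<in> R_imp"
            unfolding RImp R_imp_def by blast
        qed (use step.prems(2) 2 in simp)
      next
        case False
        show ?thesis
          unfolding 2(2)
        proof (rule derivable_single)
          show "derivable S ?C (add_mset B \<Gamma> \<turnstile> {#C#})"
            using wf False by (intro prem[of "{#Lft B, Rgt C#}"]) (auto simp: RImp)
          show "Ri_imp \<in> ?C" using rules False by simp
          show "([add_mset B \<Gamma> \<turnstile> {#C#}], \<Gamma> \<turnstile> add_mset A \<Delta>') \<in> Ri_imp"
            unfolding RImp Ri_imp_def by blast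
        qed (use step.prems(2) 2 in simp)
      qed
    next
      case (RAll x B)
      obtain a where a: "a \<notin> fv_seq (\<Gamma> \<turnstile> add_mset A \<Delta>')" by (rule obtain_eigenvariable)
      let ?B = "subst_fm (Bound x) (Var (Free a)) B"
      have wfB: "is_formula S ?B"
        using wf is_formula_instance[of S x B "Var (Free a)"] RAll by simp
      show ?thesis
      proof (cases "l = Classical")
        case True
        show ?thesis
          unfolding 2(2)
        proof (rule derivable_single)
          show "derivable S ?C (\<Gamma> \<turnstile> add_mset ?B \<Delta>')"
            using wf wfB True by (intro prem[of "{#Rgt ?B#}"]) (auto simp: RAll)
          show "R_all \<in> ?C" using rules True by simp
          show "([\<Gamma> \<turnstile> add_mset ?B \<Delta>'], \<Gamma> \<turnstile> add_mset A \<Delta>') \<in> R_all"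
            using a unfolding RAll R_all_def by blast
        qed (use step.prems(2) 2 in simp)
      next
        case False
        show ?thesis
          unfolding 2(2)
        proof (rule derivable_single)
          show "derivable S ?C (\<Gamma> \<turnstile> {#?B#})"
            using wf wfB False by (intro prem[of "{#Rgt ?B#}"]) (auto simp: RAll)
          show "Ri_all \<in> ?C" using rules False by simp
          show "([\<Gamma> \<turnstile> {#?B#}], \<Gamma> \<turnstile> add_mset A \<Delta>') \<in> Ri_all"
            using a unfolding RAll Ri_all_def by blast
        qed (use step.prems(2) 2 in simp)
      qed
    next
      case (REx t x B)
      show ?thesis
        unfolding 2(2)
      proof (rule derivable_single)
        show "derivable S ?C (\<Gamma> \<turnstile> add_mset A (add_mset (subst_fm (Bound x) t B) \<Delta>'))"
          using wf is_formula_instance[of S x B t] REx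
          by (intro prem[of "{#Rgt A, Rgt (subst_fm (Bound x) t B)#}"]) auto
        show "R_ex S \<in> ?C" using rules by simp
        show "([\<Gamma> \<turnstile> add_mset A (add_mset (subst_fm (Bound x) t B) \<Delta>')], \<Gamma> \<turnstile> add_mset A \<Delta>') \<in> R_ex S"
          unfolding REx R_ex_def using REx(3) by blast
      qed (use step.prems(2) 2 in simp)
    qed
  qed
qed

section \<open>Equivalence and admissibility\<close>

lemma derivable_iff_prov:
  "derivable S (G3 S l \<union> R12_rlplus_prec prec) s \<longleftrightarrow> is_sequent S s \<and> prov S l (signed s)"
proof
  assume der: "derivable S (G3 S l \<union> R12_rlplus_prec prec) s"
  then have "prov S l (signed (inst_seq (\<lambda>a. Var (Free a)) s))"
    using calculus_sound unfolding instances_provable_def by (metis is_term_Free)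
  then show "is_sequent S s \<and> prov S l (signed s)"
    using derivable_is_sequent[OF der] by simp
next
  assume "is_sequent S s \<and> prov S l (signed s)"
  then show "derivable S (G3 S l \<union> R12_rlplus_prec prec) s"
    using calculus_complete by (cases s) blast
qed

text \<open>From premiss to conclusion, weakening and contraction never remove a formula from the set of signed
formulas, on which provability depends monotonically.\<close>

lemma structural_rule_sound:
  assumes "\<rho> \<in> structural_rules" "(ps, c) \<in> \<rho>" and prems: "\<And>p. p \<in> set ps \<Longrightarrow> prov S l (signed p)"
  shows "prov S l (signed c)"
proof (cases "\<rho> = Cut")
  case True
  then obtain A \<Gamma> \<Delta> \<Lambda> \<Theta> where c: "c = (\<Gamma> + \<Lambda> \<turnstile> \<Delta> + \<Theta>)"
    and ps: "ps = [\<Gamma> \<turnstile> add_mset A \<Delta>, add_mset A \<Lambda> \<turnstile> \<Theta>]"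
    using assms(2) by (auto simp: Cut_def)
  have "prov S l (add_mset (Rgt A) (signed (\<Gamma> \<turnstile> \<Delta>)))"
    using prems[of "\<Gamma> \<turnstile> add_mset A \<Delta>"] ps by simp
  moreover have "prov S l (add_mset (Lft A) (signed (\<Lambda> \<turnstile> \<Theta>)))"
    using prems[of "add_mset A \<Lambda> \<turnstile> \<Theta>"] ps by simp
  ultimately have "prov S l (signed (\<Gamma> \<turnstile> \<Delta>) + signed (\<Lambda> \<turnstile> \<Theta>))" by (rule prov_cut)
  then show ?thesis by (simp add: c ac_simps)
next
  case False
  then obtain p where p: "p \<in> set ps" "set_mset (signed p) \<subseteq> set_mset (signed c)"
    using assms(1,2) by (fastforce simp: structural_rules_def WeakL_def WeakR_def ContrL_def ContrR_def)
  show ?thesis using prems[OF p(1)] p(2) by (rule prov_set_mono)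
qed

theorem theorem23:
  fixes S :: "('f, 'p) signature"
    and prec :: "'f tm \<Rightarrow> 'f tm \<Rightarrow> bool"
    and l :: logic
  assumes "antisymp_on {t. is_term S t} prec"
  shows "equivalent S (initial l \<union> R12_r) (initial l \<union> R12_rlplus_prec prec)
    \<and> (\<forall>\<rho> \<in> structural_rules. admissible S (G3 S l \<union> R12_rlplus_prec prec) \<rho>)"
proof
  show "equivalent S (initial l \<union> R12_r) (initial l \<union> R12_rlplus_prec prec)"
    unfolding equivalent_def
  proof
    fix s :: "('f, 'p) seq"
    obtain \<Gamma> \<Delta> where s: "s = (\<Gamma> \<turnstile> \<Delta>)" by (cases s)
    have "derivable S (initial l \<union> R12_r) s \<longleftrightarrow> is_sequent S s \<and> axiomatic l (signed s)"
      using axiomatic_sound[of "initial l \<union> R12_r" l S s] derivable_is_sequent[of S _ s]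
        unrestricted_complete[of l \<Gamma> \<Delta> S "initial l \<union> R12_r"] s
      by (auto simp: R12_r_def simp del: signed.simps)
    moreover have "derivable S (initial l \<union> R12_rlplus_prec prec) s \<longleftrightarrow> is_sequent S s \<and> axiomatic l (signed s)"
      using axiomatic_sound[of "initial l \<union> R12_rlplus_prec prec" l S s] derivable_is_sequent[of S _ s]
        restricted_complete[of l \<Gamma> \<Delta> S "initial l \<union> R12_rlplus_prec prec"] s
      by (auto simp: R12_rlplus_prec_def simp del: signed.simps)
    ultimately show "derivable S (initial l \<union> R12_r) s \<longleftrightarrow> derivable S (initial l \<union> R12_rlplus_prec prec) s"
      by simp
  qed
  show "\<forall>\<rho> \<in> structural_rules. admissible S (G3 S l \<union> R12_rlplus_prec prec) \<rho>"
    unfolding admissible_def derivable_iff_prov using structural_rule_sound by fastforce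
qed

end
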